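(* Let $\alpha_1,p_1,\alpha_2,p_2>0$ satisfy (i) $\alpha_1\alpha_2>1+|\alpha_1-\alpha_2|$ and (ii) $\frac{p_1}{p_2}=\frac{\alpha_1}{\alpha_2}$, and let $X\sim BG(\alpha_1,p_1,\alpha_2,p_2)$. Let $G_n=I_2(f_n)$ with $f_n\in\mathcal{H}^{\odot2}$, $n\ge1$. If, as $n\to\infty$, $$\kappa_j(G_n)\to\kappa_j(X)=(j-1)!\left(\frac{p_1}{\alpha_1^j}+(-1)^j\frac{p_2}{\alpha_2^j}\right)\quad\text{for } 2\le j\le6,$$ then $d_3(G_n,X)\to0$ as $n\to\infty$; that is, $G_n$ converges in distribution to $X$.
   Context: Bilateral gamma: $Ga(\alpha,p)$ ($\alpha,p>0$) has density $\frac{\alpha^p}{\Gamma(p)}e^{-\alpha x}x^{p-1}$, $x>0$. If $X_1\sim Ga(\alpha_1,p_1)$ and $X_2\sim Ga(\alpha_2,p_2)$ are independent, the law of $X_1-X_2$ is denoted $BG(\alpha_1,p_1,\alpha_2,p_2)$. Metric: $d_3(Y,Z)=\sup_{h\in\mathcal{W}_3}|\mathbb{E}h(Y)-\mathbb{E}h(Z)|$, where $\mathcal{W}_3$ is the set of three times differentiable $h:\mathbb{R}\to\mathbb{R}$ with $\|h^{(k)}\|\le1$ for $k=0,1,2,3$ (supremum norm). Wiener chaos: $\mathcal{H}$ is a real separable Hilbert space, $W=\{W(h):h\in\mathcal{H}\}$ an isonormal Gaussian process over $\mathcal{H}$, $\mathcal{H}^{\odot2}$ the symmetric second tensor power of $\mathcal{H}$,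 and $I_2:\mathcal{H}^{\odot 2}\to L^2(\Omega)$ the double Wiener–Itô integral, i.e. the continuous linear map onto the second Wiener chaos with $I_2(h\otimes h)=W(h)^2-1$ for $\|h\|_{\mathcal{H}}=1$; $\mathbb{E}[I_2(f)I_2(g)]=2\langle f,g\rangle_{\mathcal{H}^{\otimes2}}$. $\kappa_m(G)=(-i)^m\frac{d^m}{dt^m}\log\mathbb{E}(e^{itG})\big|_{t=0}$ is the $m$th cumulant of $G$. *)

theory Defs
  imports "HOL-Probability.Probability"
begin

definition gamma_density :: "real \<Rightarrow> real \<Rightarrow> real \<Rightarrow> real" where
  "gamma_density \<alpha> p x =
     (if x > 0 then \<alpha> powr p / Gamma p * exp (- \<alpha> * x) * x powr (p - 1) else 0)"

definition gamma_law :: "real \<Rightarrow> real \<Rightarrow> real measure" where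
  "gamma_law \<alpha> p = density lborel (\<lambda>x. ennreal (gamma_density \<alpha> p x))"

definition bilateral_gamma :: "real \<Rightarrow> real \<Rightarrow> real \<Rightarrow> real \<Rightarrow> real measure" where
  "bilateral_gamma \<alpha>\<^sub>1 p\<^sub>1 \<alpha>\<^sub>2 p\<^sub>2 =
     distr (gamma_law \<alpha>\<^sub>1 p\<^sub>1 \<Otimes>\<^sub>M gamma_law \<alpha>\<^sub>2 p\<^sub>2) borel (\<lambda>(x, y). x - y)"

definition W3 :: "(real \<Rightarrow> real) set" where
  "W3 = {h. (\<forall>k<3. \<forall>x. (deriv ^^ k) h differentiable (at x)) \<and>
            (\<forall>k\<le>3. \<forall>x. \<bar>(deriv ^^ k) h x\<bar> \<le> 1)}"

definition d3 :: "'a measure \<Rightarrow> ('a \<Rightarrow> real) \<Rightarrow> 'b measure \<Rightarrow> ('b \<Rightarrow> real) \<Rightarrow> real" where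
  "d3 M Y N Z = (SUP h\<in>W3. \<bar>(\<integral>\<omega>. h (Y \<omega>) \<partial>M) - (\<integral>\<omega>. h (Z \<omega>) \<partial>N)\<bar>)"

text \<open>The principal logarithm suffices: the characteristic function is continuous with value
  1 at 0, and only its germ at 0 matters.\<close>

definition cumulant :: "nat \<Rightarrow> 'a measure \<Rightarrow> ('a \<Rightarrow> real) \<Rightarrow> complex" where
  "cumulant m M G = (- \<i>) ^ m *
     ((\<lambda>\<phi> t. vector_derivative \<phi> (at t)) ^^ m) (\<lambda>t. ln (char (distr M borel G) t)) 0"

definition centered_gaussian :: "'a measure \<Rightarrow> ('a \<Rightarrow> real) \<Rightarrow> bool" where
  "centered_gaussian M Y \<longleftrightarrow> Y \<in> borel_measurable M \<and>
     ((AE \<omega> in M. Y \<omega> = 0) \<or> (\<exists>\<sigma>>0. distributed M lborel Y (normal_density 0 \<sigma>)))"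

text \<open>The finite linear combinations express joint Gaussianity of the family.\<close>

definition isonormal_process :: "'a measure \<Rightarrow> ('h::real_inner \<Rightarrow> 'a \<Rightarrow> real) \<Rightarrow> bool" where
  "isonormal_process M W \<longleftrightarrow> prob_space M \<and>
     (\<forall>F a. finite F \<longrightarrow> centered_gaussian M (\<lambda>\<omega>. \<Sum>h\<in>F. a h * W h \<omega>)) \<and>
     (\<forall>g h. (\<integral>\<omega>. W g \<omega> * W h \<omega> \<partial>M) = inner g h)"

text \<open>For complete \<open>'t\<close> this determines the Hilbert space tensor product of \<open>'h\<close> with itself
  up to a unique isometric isomorphism compatible with the elementary tensors.\<close>

definition hilbert_tensor_square :: "('h::real_inner \<Rightarrow> 'h \<Rightarrow> 't::real_inner) \<Rightarrow> bool" where
  "hilbert_tensor_square tens \<longleftrightarrow> bilinear tens \<and>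
     (\<forall>a b c d. inner (tens a b) (tens c d) = inner a c * inner b d) \<and>
     closure (span {tens a b | a b. True}) = UNIV"

definition symmetric_square :: "('h::real_inner \<Rightarrow> 'h \<Rightarrow> 't::real_inner) \<Rightarrow> 't set" where
  "symmetric_square tens = closure (span {tens a b + tens b a | a b. True})"

text \<open>Elements of \<open>L\<^sup>2(\<Omega>)\<close> are represented by functions, so identities between them hold almost
  surely. The isometry clause contains the continuity of \<open>I2\<close>; since the domain is complete,
  it also makes the range closed, hence equal to the closed span of the variables
  \<open>W(h)\<^sup>2 - 1\<close> with \<open>h\<close> a unit vector, the second Wiener chaos. Only the values of \<open>I2\<close> on
  the symmetric square matter.\<close>

definition double_wiener_integral ::
  "'a measure \<Rightarrow> ('h::real_inner \<Rightarrow> 'a \<Rightarrow> real) \<Rightarrow> ('h \<Rightarrow> 'h \<Rightarrow> 't::real_inner) \<Rightarrow>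
   ('t \<Rightarrow> 'a \<Rightarrow> real) \<Rightarrow> bool" where
  "double_wiener_integral M W tens I2 \<longleftrightarrow>
     (\<forall>f\<in>symmetric_square tens.
        I2 f \<in> borel_measurable M \<and> integrable M (\<lambda>\<omega>. (I2 f \<omega>)\<^sup>2)) \<and>
     (\<forall>f\<in>symmetric_square tens. \<forall>g\<in>symmetric_square tens. \<forall>a b.
        AE \<omega> in M. I2 (a *\<^sub>R f + b *\<^sub>R g) \<omega> = a * I2 f \<omega> + b * I2 g \<omega>) \<and>
     (\<forall>h. norm h = 1 \<longrightarrow> (AE \<omega> in M. I2 (tens h h) \<omega> = (W h \<omega>)\<^sup>2 - 1)) \<and>
     (\<forall>f\<in>symmetric_square tens. \<forall>g\<in>symmetric_square tens.
        (\<integral>\<omega>. I2 f \<omega> * I2 g \<omega> \<partial>M) = 2 * inner f g)"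

end

(*
  A finite-rank symmetric tensor is diagonalized as a sum of l_k e_k (x) e_k with orthonormal e_k, so
  its double integral is the sum of l_k (N_k^2 - 1) with independent standard normals N_k; with
  mu_k = 2 l_k its cumulant of order j is (j-1)!/2 times the j-th power sum of the mu_k. By density,
  each G_n is close, in law and in its cumulants of orders 2 to 6, to such a finite sum. The
  hypothesis on the cumulants then makes the sum of mu^2 (mu - a)^2 (mu + b)^2, where a = 1/alpha_1
  and b = 1/alpha_2, tend to 0: the measure with weight mu^2/2 at mu concentrates on {a, -b}. Its
  limiting masses are given by the power sums of orders 2 and 3, and so the characteristic functions
  converge to that of X. Skorohod's coupling turns weak convergence into convergence in d_3.
*)

theory Submission
  imports Defs "HOL-Complex_Analysis.Complex_Analysis" "HOL-Real_Asymp.Real_Asymp"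
begin

text \<open>Both sides have a log characteristic function of one form, a weighted sum of
  \<open>chi2_cgf x t\<close> over points \<open>x\<close>. For a finite chi-square sum the points
  are the \<mu> and the weights are 1; for \<open>X\<close> they are a and -b with weights
  \<open>2 * p\<^sub>1\<close> and \<open>2 * p\<^sub>2\<close>. Condition (ii) is what puts
  \<open>X\<close> into this form: it says that \<open>X\<close> has mean 0, so that the linear
  terms of the two \<open>chi2_cgf\<close> cancel. The obstacle is that \<open>cumulant\<close>
  differentiates the principal logarithm of a characteristic function along the real line, whereas
  approximating a tensor in norm controls only the values of characteristic functions. The
  finite-rank approximants, however, have holomorphic log characteristic functions on one common
  disc, whose radius is fixed by a bound on the sum of \<mu>^2, and there they are bounded by 1.
  Hence they form a normal family, and the same bound keeps the logarithm on its principal branch.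
  As each G_n is approximated separately in this way, finite-dimensional diagonalization is
  enough.\<close>

section \<open>Cumulant generating functions\<close>

text \<open>The logarithm of \<open>E exp (i z x (N\<^sup>2 - 1) / 2)\<close> for a standard normal variable \<open>N\<close>.\<close>

definition chi2_cgf :: "real \<Rightarrow> complex \<Rightarrow> complex" where
  "chi2_cgf x z = (- Ln (1 - \<i> * x * z) - \<i> * x * z) / 2"

lemma chi2_cgf_0 [simp]: "chi2_cgf x 0 = 0"
  by (simp add: chi2_cgf_def)

lemma chi2_cgf_has_field_derivative:
  assumes "Re (1 - \<i> * x * z) > 0"
  shows "(chi2_cgf x has_field_derivative ((\<i> * x / (1 - \<i> * x * z) - \<i> * x) / 2)) (at z)"
proof -
  have nz: "1 - \<i> * x * z \<notin> \<real>\<^sub>\<le>\<^sub>0" using assms by (auto simp: complex_nonpos_Reals_iff)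
  have "((\<lambda>z. 1 - \<i> * x * z) has_field_derivative - (\<i> * x)) (at z)"
    by (auto intro!: derivative_eq_intros)
  note L = DERIV_chain2[OF has_field_derivative_Ln[OF nz] this]
  have "(chi2_cgf x has_field_derivative (- (inverse (1 - \<i> * x * z) * - (\<i> * x)) - \<i> * x) / 2) (at z)"
    unfolding chi2_cgf_def[abs_def] by (rule DERIV_cdivide DERIV_diff DERIV_minus L DERIV_cmult_Id)+
  moreover have "- (inverse c * - a) = a / c" for a c :: complex by (simp add: field_simps)
  ultimately show ?thesis by (simp only:)
qed

text \<open>The derivative of - Ln (1 - v) - v is v / (1 - v), at most 2 |w| on the segment from 0
  to w = i x z, and the mean value inequality gives the square. Sums over many eigenvalues are thus
  controlled by their square sum alone. Only a real part is restricted, so the bound covers both a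
  small complex disc and all real z, for which i x z is purely imaginary.\<close>

lemma norm_chi2_cgf_le:
  assumes "Re (\<i> * x * z) \<le> 1 / 2"
  shows "norm (chi2_cgf x z) \<le> (norm (x * z))\<^sup>2"
proof -
  define w where "w = \<i> * x * z"
  have nw: "norm w = norm (x * z)" by (simp add: w_def norm_mult)
  let ?h = "\<lambda>v. - Ln (1 - v) - v"
  have "norm (?h w - ?h 0) \<le> (2 * norm w) * norm (w - 0)"
  proof (rule field_differentiable_bound)
    show "convex (closed_segment 0 w)" by simp
    fix v assume "v \<in> closed_segment 0 w"
    then obtain s where s: "0 \<le> s" "s \<le> 1" "v = of_real s * w"
      by (auto simp: closed_segment_def scaleR_conv_of_real)
    have "s * Re w \<le> 1 / 2"
    proof (cases "Re w \<ge> 0")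
      case True
      then have "s * Re w \<le> Re w" using s by (intro mult_left_le_one_le)
      then show ?thesis using assms unfolding w_def by linarith
    next
      case False
      then have "s * Re w \<le> 0" using s by (intro mult_nonneg_nonpos) auto
      then show ?thesis by linarith
    qed
    then have R: "Re (1 - v) \<ge> 1 / 2" by (simp add: s)
    then have "1 - v \<notin> \<real>\<^sub>\<le>\<^sub>0" by (auto simp: complex_nonpos_Reals_iff)
    then show "(?h has_field_derivative (1 / (1 - v) - 1)) (at v within closed_segment 0 w)"
      by (auto intro!: derivative_eq_intros simp: divide_inverse)
    have n: "norm (1 - v) \<ge> 1 / 2" using R abs_Re_le_cmod[of "1 - v"] by linarith
    then have "1 - v \<noteq> 0" by auto
    then have "1 / (1 - v) - 1 = v / (1 - v)" by (simp add: field_simps)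
    moreover have "norm v \<le> norm w" using s by (simp add: norm_mult mult_left_le_one_le)
    ultimately show "norm (1 / (1 - v) - 1) \<le> 2 * norm w"
      using n frac_le[of "norm w" "norm v" "1/2" "norm (1 - v)"] by (simp add: norm_divide)
  qed auto
  then have "norm (?h w) \<le> 2 * (norm w)\<^sup>2" by (simp add: power2_eq_square)
  then show ?thesis
    unfolding chi2_cgf_def nw[symmetric] w_def[symmetric] by (simp add: norm_divide)
qed

lemma holomorphic_on_sum_chi2_cgf:
  "(\<lambda>z. \<Sum>u\<in>A. w u * chi2_cgf (x u) z) holomorphic_on {z. \<forall>u\<in>A. Re (1 - \<i> * x u * z) > 0}"
proof (intro holomorphic_intros)
  fix u assume "u \<in> A"
  then show "chi2_cgf (x u) holomorphic_on {z. \<forall>u\<in>A. Re (1 - \<i> * x u * z) > 0}"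
    unfolding holomorphic_on_def field_differentiable_def
    using chi2_cgf_has_field_derivative has_field_derivative_at_within by blast
qed

text \<open>The closed form begins at order 2 because the linear term of \<open>chi2_cgf\<close>
  spoils the pattern at order 1; the first derivative is computed apart and the induction starts
  above it.\<close>

lemma higher_deriv_sum_chi2_cgf:
  assumes "finite A" "\<forall>u\<in>A. Re (1 - \<i> * x u * z) > 0"
  shows "(deriv ^^ (n + 2)) (\<lambda>z. \<Sum>u\<in>A. w u * chi2_cgf (x u) z) z =
    (\<Sum>u\<in>A. w u * ((\<i> * x u) ^ (n + 2) * fact (n + 1) / (2 * (1 - \<i> * x u * z) ^ (n + 2))))"
proof -
  define S where "S = {z. \<forall>u\<in>A. Re (1 - \<i> * x u * z) > 0}"
  have "S = (\<Inter>u\<in>A. {z. Re (1 - \<i> * x u * z) > 0})" by (auto simp: S_def)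
  also have "open \<dots>"
    using assms(1) by (intro open_INT ballI open_Collect_less continuous_intros)
  finally have "open S" .
  have nz: "1 - \<i> * x u * z \<noteq> 0" if "z \<in> S" "u \<in> A" for u z
  proof
    assume "1 - \<i> * x u * z = 0"
    then have "Re (1 - \<i> * x u * z) = 0" by simp
    with that show False unfolding S_def by fastforce
  qed
  \<comment> \<open>Each derivative is known only on \<open>S\<close>; since \<open>S\<close> is
    open, \<open>deriv\<close> at a point of \<open>S\<close> may be computed from the
    formula.\<close>
  have deriv_cong: "deriv f z = D" if "z \<in> S" "\<And>z. z \<in> S \<Longrightarrow> f z = g z" "(g has_field_derivative D) (at z)" for f g z D
    using that \<open>open S\<close> by (intro DERIV_imp_deriv) (rule has_field_derivative_transform_within_open[of g _ _ S], auto)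
  let ?F = "\<lambda>z. \<Sum>u\<in>A. w u * chi2_cgf (x u) z"
  have 1: "(deriv ^^ 1) ?F z = (\<Sum>u\<in>A. w u * ((\<i> * x u / (1 - \<i> * x u * z) - \<i> * x u) / 2))" if "z \<in> S" for z
  proof -
    have "(?F has_field_derivative (\<Sum>u\<in>A. w u * ((\<i> * x u / (1 - \<i> * x u * z) - \<i> * x u) / 2))) (at z)"
      using that unfolding S_def by (intro DERIV_sum DERIV_cmult chi2_cgf_has_field_derivative) auto
    then show ?thesis by (simp add: DERIV_imp_deriv)
  qed
  have 2: "z \<in> S \<Longrightarrow> (deriv ^^ (n + 2)) ?F z =
    (\<Sum>u\<in>A. w u * ((\<i> * x u) ^ (n + 2) * fact (n + 1) / (2 * (1 - \<i> * x u * z) ^ (n + 2))))" for n z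
  proof (induction n arbitrary: z)
    case 0
    have "(deriv ^^ (0 + 2)) ?F z = deriv ((deriv ^^ 1) ?F) z" by (simp add: numeral_2_eq_2)
    also have "\<dots> = (\<Sum>u\<in>A. w u * ((\<i> * x u) ^ (0 + 2) * fact (0 + 1) / (2 * (1 - \<i> * x u * z) ^ (0 + 2))))"
    proof (rule deriv_cong[OF 0 1])
      have "((\<lambda>z. (\<i> * x u / (1 - \<i> * x u * z) - \<i> * x u) / 2) has_field_derivative
         (\<i> * x u) ^ (0 + 2) * fact (0 + 1) / (2 * (1 - \<i> * x u * z) ^ (0 + 2))) (at z)" if "u \<in> A" for u
      proof -
        define a where "a = \<i> * x u"
        have a: "1 - a * z \<noteq> 0" using nz[OF 0 that] by (simp add: a_def)
        have "((\<lambda>z. 1 - a * z) has_field_derivative - a) (at z)"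
          by (auto intro!: derivative_eq_intros)
        from DERIV_cdivide[OF DERIV_diff[OF DERIV_cmult[OF DERIV_inverse'[OF this a], of a] DERIV_const[of a]], of 2]
        have "((\<lambda>z. (a / (1 - a * z) - a) / 2) has_field_derivative
            (a * - (inverse (1 - a * z) * - a * inverse (1 - a * z)) - 0) / 2) (at z)"
          by (simp only: divide_inverse)
        \<comment> \<open>Stated for an arbitrary nonzero \<open>b\<close>, so that simplification
          treats 1 - a z as an atom.\<close>
        moreover have "(a * - (inverse b * - a * inverse b) - 0) / 2 = a ^ (0 + 2) * fact (0 + 1) / (2 * b ^ (0 + 2))"
          if "b \<noteq> 0" for b
          using that by (simp add: field_simps power2_eq_square)
        ultimately show ?thesis unfolding a_def[symmetric] using a by metis
      qed
      then show "((\<lambda>z. \<Sum>u\<in>A. w u * ((\<i> * x u / (1 - \<i> * x u * z) - \<i> * x u) / 2)) has_field_derivative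
         (\<Sum>u\<in>A. w u * ((\<i> * x u) ^ (0 + 2) * fact (0 + 1) / (2 * (1 - \<i> * x u * z) ^ (0 + 2))))) (at z)"
        by (intro DERIV_sum DERIV_cmult)
    qed
    finally show ?case .
  next
    case (Suc n)
    have "(deriv ^^ (Suc n + 2)) ?F z = deriv ((deriv ^^ (n + 2)) ?F) z" by simp
    also have "\<dots> = (\<Sum>u\<in>A. w u * ((\<i> * x u) ^ (Suc n + 2) * fact (Suc n + 1) / (2 * (1 - \<i> * x u * z) ^ (Suc n + 2))))"
    proof (rule deriv_cong[OF Suc.prems Suc.IH])
      have "((\<lambda>z. (\<i> * x u) ^ (n + 2) * fact (n + 1) / (2 * (1 - \<i> * x u * z) ^ (n + 2))) has_field_derivative
         ((\<i> * x u) ^ (Suc n + 2) * fact (Suc n + 1) / (2 * (1 - \<i> * x u * z) ^ (Suc n + 2)))) (at z)" if "u \<in> A" for u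
      proof -
        define a where "a = \<i> * x u"
        have a: "1 - a * z \<noteq> 0" using nz[OF Suc.prems that] by (simp add: a_def)
        have "((\<lambda>z. 1 - a * z) has_field_derivative - a) (at z)"
          by (auto intro!: derivative_eq_intros)
        from DERIV_power[OF this, of "n + 2"]
        have "((\<lambda>z. (1 - a * z) ^ (n + 2)) has_field_derivative (of_nat (n + 2) * (- a * (1 - a * z) ^ (n + 1)))) (at z)" by simp
        from DERIV_inverse'[OF this] a
        have "((\<lambda>z. inverse ((1 - a * z) ^ (n + 2))) has_field_derivative
           - (inverse ((1 - a * z) ^ (n + 2)) * (of_nat (n + 2) * (- a * (1 - a * z) ^ (n + 1))) * inverse ((1 - a * z) ^ (n + 2)))) (at z)"
          by simp
        also have "- (inverse ((1 - a * z) ^ (n + 2)) * (of_nat (n + 2) * (- a * (1 - a * z) ^ (n + 1))) * inverse ((1 - a * z) ^ (n + 2)))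
            = of_nat (n + 2) * a * inverse ((1 - a * z) ^ (n + 3))"
        proof -
          have "- (inverse (b ^ (n + 2)) * (c * (- a * b ^ (n + 1))) * inverse (b ^ (n + 2))) = c * a * inverse (b ^ (n + 3))"
            if "b \<noteq> 0" for b c
            using that by (simp add: field_simps power_add power2_eq_square power3_eq_cube)
          from this[OF a] show ?thesis .
        qed
        finally have "((\<lambda>z. (a ^ (n + 2) * fact (n + 1) / 2) * inverse ((1 - a * z) ^ (n + 2))) has_field_derivative
           (a ^ (n + 2) * fact (n + 1) / 2) * (of_nat (n + 2) * a * inverse ((1 - a * z) ^ (n + 3)))) (at z)"
          by (rule DERIV_cmult)
        moreover have "(a ^ (n + 2) * F / 2) * inverse (b ^ (n + 2)) = a ^ (n + 2) * F / (2 * b ^ (n + 2))" for F b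
          by (simp add: inverse_eq_divide)
        moreover have "(a ^ (n + 2) * fact (n + 1) / 2) * (of_nat (n + 2) * a * inverse ((1 - a * z) ^ (n + 3))) =
            a ^ (Suc n + 2) * fact (Suc n + 1) / (2 * (1 - a * z) ^ (Suc n + 2))"
        proof -
          have "(p * F / 2) * (c * a * inverse q) = a * p * (c * F) / (2 * q)" for p F c q :: complex
            by (simp add: inverse_eq_divide)
          moreover have "a ^ (Suc n + 2) = a * a ^ (n + 2)" "fact (Suc n + 1) = of_nat (n + 2) * (fact (n + 1) :: complex)"
            "n + 3 = Suc n + 2" by simp_all
          ultimately show ?thesis by metis
        qed
        ultimately show ?thesis unfolding a_def[symmetric] by (simp only:)
      qed
      then show "((\<lambda>z. \<Sum>u\<in>A. w u * ((\<i> * x u) ^ (n + 2) * fact (n + 1) / (2 * (1 - \<i> * x u * z) ^ (n + 2)))) has_field_derivative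
         (\<Sum>u\<in>A. w u * ((\<i> * x u) ^ (Suc n + 2) * fact (Suc n + 1) / (2 * (1 - \<i> * x u * z) ^ (Suc n + 2))))) (at z)"
        by (intro DERIV_sum DERIV_cmult)
    qed
    finally show ?case .
  qed
  show ?thesis using 2 assms(2) by (simp add: S_def)
qed

lemma higher_deriv_sum_chi2_cgf_0:
  assumes "finite A" "j \<ge> 2"
  shows "(- \<i>) ^ j * (deriv ^^ j) (\<lambda>z. \<Sum>u\<in>A. of_real (w u) * chi2_cgf (x u) z) 0 =
    of_real (fact (j - 1) * (\<Sum>u\<in>A. w u * x u ^ j) / 2)"
proof -
  obtain n where n: "j = n + 2" using assms(2) le_Suc_ex by (metis add.commute)
  have ii: "(- \<i>) ^ j * (\<i> * x) ^ j = x ^ j" for x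
    by (simp flip: power_mult_distrib)
  have "(- \<i>) ^ j * (deriv ^^ j) (\<lambda>z. \<Sum>u\<in>A. of_real (w u) * chi2_cgf (x u) z) 0 =
    (- \<i>) ^ j * (\<Sum>u\<in>A. w u * ((\<i> * x u) ^ j * fact (j - 1) / 2))"
    unfolding n using higher_deriv_sum_chi2_cgf[OF assms(1), of x 0 n "\<lambda>u. of_real (w u)"] by simp
  also have "\<dots> = (\<Sum>u\<in>A. w u * (((- \<i>) ^ j * (\<i> * x u) ^ j) * fact (j - 1) / 2))"
    by (simp add: sum_distrib_left mult_ac)
  also have "\<dots> = of_real (fact (j - 1) * (\<Sum>u\<in>A. w u * x u ^ j) / 2)"
    unfolding ii by (simp add: sum_distrib_left sum_divide_distrib mult_ac)
  finally show ?thesis .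
qed

text \<open>\<open>cumulant\<close> iterates the derivative along the real line, and each iteration
  needs the previous derivative on a whole interval. The claim is therefore made for all
  \<open>t\<close> of the interval, although its value at 0 is what is wanted.\<close>

lemma iterated_vector_derivative_holomorphic:
  assumes G: "G holomorphic_on ball 0 r" and eq: "\<And>t. \<bar>t\<bar> < r \<Longrightarrow> \<psi> t = G (of_real t)" and "\<bar>t\<bar> < r"
  shows "((\<lambda>\<phi> t. vector_derivative \<phi> (at t)) ^^ m) \<psi> t = (deriv ^^ m) G (of_real t)"
  using \<open>\<bar>t\<bar> < r\<close>
proof (induction m arbitrary: t)
  case 0
  then show ?case using eq by simp
next
  case (Suc m)
  let ?\<psi> = "((\<lambda>\<phi> t. vector_derivative \<phi> (at t)) ^^ m) \<psi>" and ?G = "(deriv ^^ m) G"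
  have "?G holomorphic_on ball 0 r" using G by (intro holomorphic_higher_deriv) auto
  moreover have "complex_of_real t \<in> ball 0 r" using Suc.prems by simp
  ultimately have "(?G has_field_derivative deriv ?G (of_real t)) (at (of_real t))"
    by (intro holomorphic_derivI[of _ "ball 0 r"]) auto
  then have "((\<lambda>t. ?G (of_real t)) has_vector_derivative deriv ?G (of_real t)) (at t)"
    by (rule has_vector_derivative_real_field)
  then have "(?\<psi> has_vector_derivative deriv ?G (of_real t)) (at t)"
    by (rule has_vector_derivative_transform_within_open[of _ _ _ "{-r<..<r}"]) (use Suc in auto)
  then show ?case by (simp add: vector_derivative_at)
qed

text \<open>Montel's theorem upgrades the pointwise convergence of characteristic functions on the real
  axis to convergence of all derivatives at 0.\<close>

lemma cgf_derivatives_limit: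
  fixes F :: "nat \<Rightarrow> complex \<Rightarrow> complex" and \<phi> :: "real \<Rightarrow> complex"
  assumes "r > 0" and hol: "\<And>m. F m holomorphic_on ball 0 r"
    and bound: "\<And>m z. z \<in> ball 0 r \<Longrightarrow> norm (F m z) \<le> 1"
    and lim: "\<And>t. \<bar>t\<bar> < r \<Longrightarrow> (\<lambda>m. exp (F m (of_real t))) \<longlonglongrightarrow> \<phi> t"
  obtains s where "strict_mono s"
    "\<And>j. (\<lambda>m. (deriv ^^ j) (F (s m)) 0) \<longlonglongrightarrow> ((\<lambda>\<phi> t. vector_derivative \<phi> (at t)) ^^ j) (\<lambda>t. Ln (\<phi> t)) 0"
proof -
  obtain G s where G: "G holomorphic_on ball 0 r" and s: "strict_mono (s :: nat \<Rightarrow> nat)"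
    and ptw: "\<And>x. x \<in> ball 0 r \<Longrightarrow> (\<lambda>n. F (s n) x) \<longlonglongrightarrow> G x"
    and unif: "\<And>K. compact K \<Longrightarrow> K \<subseteq> ball 0 r \<Longrightarrow> uniform_limit K (F \<circ> s) G sequentially"
  proof (rule Montel[of "ball 0 r" "range F" F])
    show "\<exists>B. \<forall>h\<in>range F. \<forall>z\<in>K. norm (h z) \<le> B" if "compact K" "K \<subseteq> ball 0 r" for K
      using that(2) bound by (intro exI[of _ 1]) blast
  qed (use hol in auto)
  have Ln: "Ln (\<phi> t) = G (of_real t)" if "\<bar>t\<bar> < r" for t
  proof -
    have t: "complex_of_real t \<in> ball 0 r" using that by simp
    have "(\<lambda>n. exp (F (s n) (of_real t))) \<longlonglongrightarrow> exp (G (of_real t))"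
      by (intro tendsto_exp ptw t)
    moreover have "(\<lambda>n. exp (F (s n) (of_real t))) \<longlonglongrightarrow> \<phi> t"
      using LIMSEQ_subseq_LIMSEQ[OF lim[OF that] s] by (simp add: comp_def)
    ultimately have "\<phi> t = exp (G (of_real t))" by (rule LIMSEQ_unique[symmetric])
    \<comment> \<open>The bound 1 in the hypotheses lies below pi: it keeps the imaginary part of
      \<open>G\<close> in the range where \<open>Ln\<close> inverts \<open>exp\<close>.\<close>
    moreover have "norm (G (of_real t)) \<le> 1"
      using bound[OF t] by (intro tendsto_upperbound[OF tendsto_norm[OF ptw[OF t]]]) auto
    then have "\<bar>Im (G (of_real t))\<bar> \<le> 1" using abs_Im_le_cmod order_trans by blast
    then have "- pi < Im (G (of_real t))" "Im (G (of_real t)) \<le> pi" using pi_gt3 by linarith+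
    ultimately show ?thesis by simp
  qed
  have "(\<lambda>m. (deriv ^^ j) (F (s m)) 0) \<longlonglongrightarrow> (deriv ^^ j) G 0" for j
  proof (rule higher_deriv_complex_uniform_limit)
    \<comment> \<open>Montel's theorem gives uniform convergence on compact subsets only, hence the
      smaller disc.\<close>
    show "uniform_limit (ball 0 (r / 2)) (\<lambda>m. F (s m)) G sequentially"
    proof (rule uniform_limit_on_subset)
      show "uniform_limit (cball 0 (r / 2)) (\<lambda>m. F (s m)) G sequentially"
        using unif[of "cball 0 (r / 2)"] \<open>r > 0\<close> unfolding comp_def by (simp add: subset_iff)
    qed auto
    show "\<forall>\<^sub>F n in sequentially. F (s n) holomorphic_on ball 0 (r / 2)"
      using hol \<open>r > 0\<close> by (intro always_eventually allI holomorphic_on_subset[OF hol]) auto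
  qed (use \<open>r > 0\<close> in auto)
  moreover have "((\<lambda>\<phi> t. vector_derivative \<phi> (at t)) ^^ j) (\<lambda>t. Ln (\<phi> t)) 0 = (deriv ^^ j) G 0" for j
    using iterated_vector_derivative_holomorphic[OF G, of "\<lambda>t. Ln (\<phi> t)" 0 j] Ln \<open>r > 0\<close> by simp
  ultimately show ?thesis using that s by simp
qed

text \<open>The only difficulty is the branch of the logarithm. Near 0 the exponent has norm below 1
  by continuity, so \<open>cgf_derivatives_limit\<close> applies to the constant sequence with value
  \<open>F\<close>.\<close>

lemma cumulant_of_cgf:
  assumes "finite A" "j \<ge> 2"
    and ch: "\<And>t. char (distr N borel X) t = exp (\<Sum>u\<in>A. of_real (w u) * chi2_cgf (x u) (of_real t))"
  shows "cumulant j N X = of_real (fact (j - 1) * (\<Sum>u\<in>A. w u * x u ^ j) / 2)"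
proof -
  define F where "F z = (\<Sum>u\<in>A. of_real (w u) * chi2_cgf (x u) z)" for z
  define S where "S = {z. \<forall>u\<in>A. Re (1 - \<i> * x u * z) > 0}"
  have "S = (\<Inter>u\<in>A. {z. Re (1 - \<i> * x u * z) > 0})" by (auto simp: S_def)
  also have "open \<dots>"
    using assms(1) by (intro open_INT ballI open_Collect_less continuous_intros)
  finally have "open S" .
  have hol: "F holomorphic_on S"
    unfolding F_def[abs_def] S_def by (rule holomorphic_on_sum_chi2_cgf)
  have "0 \<in> S" "F 0 = 0" by (simp_all add: S_def F_def)
  have "isCont F 0"
    using holomorphic_on_imp_continuous_on[OF hol] \<open>open S\<close> \<open>0 \<in> S\<close> by (simp add: continuous_on_eq_continuous_at)
  then obtain d where d: "d > 0" "\<And>z. dist z 0 < d \<Longrightarrow> dist (F z) (F 0) < 1"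
    unfolding continuous_at_eps_delta using zero_less_one by metis
  obtain e where e: "e > 0" "ball 0 e \<subseteq> S"
    using \<open>open S\<close> \<open>0 \<in> S\<close> open_contains_ball by blast
  obtain s where der: "(\<lambda>m::nat. (deriv ^^ j) F 0) \<longlonglongrightarrow>
      ((\<lambda>\<phi> t. vector_derivative \<phi> (at t)) ^^ j) (\<lambda>t. Ln (char (distr N borel X) t)) 0"
  proof (rule cgf_derivatives_limit[of "min d e" "\<lambda>m. F" "char (distr N borel X)"])
    show "F holomorphic_on ball 0 (min d e)"
      by (rule holomorphic_on_subset[OF hol]) (use e in auto)
    show "norm (F z) \<le> 1" if "z \<in> ball 0 (min d e)" for z
      using d(2)[of z] that \<open>F 0 = 0\<close> by (simp add: dist_commute less_imp_le)
    show "(\<lambda>m. exp (F (of_real t))) \<longlonglongrightarrow> char (distr N borel X) t" for t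
      by (simp add: ch F_def)
  qed (use d e in auto)
  then have "((\<lambda>\<phi> t. vector_derivative \<phi> (at t)) ^^ j) (\<lambda>t. Ln (char (distr N borel X) t)) 0 = (deriv ^^ j) F 0"
    by (simp add: LIMSEQ_const_iff)
  then show ?thesis
    unfolding cumulant_def using higher_deriv_sum_chi2_cgf_0[OF assms(1,2), of w x] by (simp add: F_def[abs_def])
qed

section \<open>Gamma and chi-square laws\<close>

lemma has_vector_derivative_iff_LIM:
  fixes f :: "real \<Rightarrow> 'b::real_normed_vector"
  shows "(f has_vector_derivative D) (at t) \<longleftrightarrow> ((\<lambda>s. (f s - f t) /\<^sub>R (s - t)) \<longlongrightarrow> D) (at t)"
proof -
  have "norm (f s - f t - (s - t) *\<^sub>R D) / norm (s - t) = norm ((f s - f t) /\<^sub>R (s - t) - D)" if "s \<noteq> t" for s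
  proof -
    have "(f s - f t) /\<^sub>R (s - t) - D = (f s - f t - (s - t) *\<^sub>R D) /\<^sub>R (s - t)"
      using that by (simp add: scaleR_right_diff_distrib)
    then show ?thesis by (simp add: divide_inverse mult.commute)
  qed
  then have "((\<lambda>s. norm (f s - f t - (s - t) *\<^sub>R D) / norm (s - t)) \<longlongrightarrow> 0) (at t) \<longleftrightarrow>
     ((\<lambda>s. norm ((f s - f t) /\<^sub>R (s - t) - D)) \<longlongrightarrow> 0) (at t)"
    by (intro filterlim_cong) (auto simp: eventually_at intro!: exI[of _ 1])
  then show ?thesis
    unfolding has_vector_derivative_def has_derivative_iff_norm
    by (simp add: bounded_linear_scaleR_left tendsto_norm_zero_iff LIM_zero_iff)
qed

lemma norm_iexp_diff_le: "norm (iexp a - iexp b) \<le> \<bar>a - b\<bar>"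
proof -
  have "iexp a - iexp b = iexp b * (iexp (a - b) - 1)"
    by (simp add: algebra_simps flip: exp_add)
  then have "norm (iexp a - iexp b) = norm (iexp (a - b) - 1)"
    by (simp add: norm_mult del: of_real_diff)
  also have "\<dots> \<le> \<bar>a - b\<bar>"
    using iexp_approx1[of "a - b" 0] by simp
  finally show ?thesis .
qed

text \<open>Dominated convergence for the difference quotients: e^(ity) is Lipschitz in t with
  constant |y|, so \<open>\<bar>Y x\<bar>\<close> is a majorant.\<close>

lemma char_has_vector_derivative:
  fixes Y :: "'a \<Rightarrow> real"
  assumes "finite_measure M" "integrable M Y"
  shows "((\<lambda>t. \<integral>x. iexp (t * Y x) \<partial>M) has_vector_derivative
           (\<integral>x. \<i> * Y x * iexp (t * Y x) \<partial>M)) (at t)"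
proof -
  interpret finite_measure M by fact
  have [measurable]: "Y \<in> borel_measurable M" using assms by auto
  let ?f = "\<lambda>s x. iexp (s * Y x)"
  have int: "integrable M (?f s)" for s
    by (rule integrable_const_bound[of _ 1]) (auto intro!: AE_I2 simp del: of_real_mult)
  have der: "((\<lambda>s. iexp (s * y)) has_vector_derivative \<i> * y * iexp (t * y)) (at t)" for y t :: real
  proof -
    have "((\<lambda>z. exp (\<i> * (z * of_real y))) has_field_derivative \<i> * y * iexp (t * y)) (at (of_real t))"
      by (auto intro!: derivative_eq_intros)
    from has_vector_derivative_real_field[OF this] show ?thesis by simp
  qed
  have lip: "norm (iexp (s * y) - iexp (t * y)) \<le> \<bar>s - t\<bar> * \<bar>y\<bar>" for s t y :: real
    using norm_iexp_diff_le[of "s * y" "t * y"] by (simp add: abs_mult flip: left_diff_distrib)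
  have "((\<lambda>s. \<integral>x. (?f s x - ?f t x) /\<^sub>R (s - t) \<partial>M) \<longlongrightarrow> (\<integral>x. \<i> * Y x * ?f t x \<partial>M)) (at t)"
    unfolding tendsto_at_iff_sequentially
  proof (intro allI impI)
    fix S assume S: "\<forall>i. S i \<in> UNIV - {t}" "S \<longlonglongrightarrow> t"
    show "((\<lambda>s. \<integral>x. (?f s x - ?f t x) /\<^sub>R (s - t) \<partial>M) \<circ> S) \<longlonglongrightarrow> (\<integral>x. \<i> * Y x * ?f t x \<partial>M)"
      unfolding comp_def
    proof (rule integral_dominated_convergence[where w="\<lambda>x. \<bar>Y x\<bar>"])
      show "AE x in M. (\<lambda>i. (?f (S i) x - ?f t x) /\<^sub>R (S i - t)) \<longlonglongrightarrow> \<i> * Y x * ?f t x"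
      proof (rule AE_I2)
        fix x
        have "((\<lambda>s. (iexp (s * Y x) - iexp (t * Y x)) /\<^sub>R (s - t)) \<longlongrightarrow> \<i> * Y x * iexp (t * Y x)) (at t)"
          using der[of "Y x" t] by (simp add: has_vector_derivative_iff_LIM)
        then show "(\<lambda>i. (?f (S i) x - ?f t x) /\<^sub>R (S i - t)) \<longlonglongrightarrow> \<i> * Y x * ?f t x"
          using S unfolding tendsto_at_iff_sequentially comp_def by blast
      qed
      show "AE x in M. norm ((?f (S i) x - ?f t x) /\<^sub>R (S i - t)) \<le> \<bar>Y x\<bar>" for i
      proof (rule AE_I2)
        fix x
        have "S i \<noteq> t" using S by auto
        then show "norm ((?f (S i) x - ?f t x) /\<^sub>R (S i - t)) \<le> \<bar>Y x\<bar>"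
          using lip[of "S i" "Y x" t] by (simp add: divide_simps mult.commute)
      qed
    qed (use assms in auto)
  qed
  moreover have "(\<integral>x. (?f s x - ?f t x) /\<^sub>R (s - t) \<partial>M) = ((\<integral>x. ?f s x \<partial>M) - (\<integral>x. ?f t x \<partial>M)) /\<^sub>R (s - t)" for s
    by (subst integral_scaleR_right) (simp only: Bochner_Integration.integral_diff[OF int int])
  ultimately show ?thesis
    unfolding has_vector_derivative_iff_LIM by (simp only:)
qed

text \<open>Here \<open>\<psi>\<close> stands for the expectation of Y e^(itY). The product of
  \<open>\<phi>\<close> with the exponential of p times the logarithm has derivative 0. The gamma
  laws and the square of a normal variable both lead to this equation through an integration by
  parts.\<close>

lemma ode_powr_unique:
  fixes \<phi> \<psi> :: "real \<Rightarrow> complex"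
  assumes "\<alpha> > 0" and der: "\<And>t. (\<phi> has_vector_derivative \<i> * \<psi> t) (at t)"
    and eq: "\<And>t. (\<alpha> - \<i> * t) * \<psi> t = p * \<phi> t" and "\<phi> 0 = 1"
  shows "\<phi> t = exp (- p * Ln (1 - \<i> * of_real (t / \<alpha>)))"
proof -
  let ?L = "\<lambda>t. Ln (1 - \<i> * of_real (t / \<alpha>))"
  have L: "(?L has_vector_derivative (- \<i> / (\<alpha> - \<i> * t))) (at t)" for t
  proof -
    have "((\<lambda>z. Ln (1 - \<i> * (z / of_real \<alpha>))) has_field_derivative (- \<i> / (\<alpha> - \<i> * t))) (at (of_real t))"
      using \<open>\<alpha> > 0\<close>
      by (auto intro!: derivative_eq_intros simp: complex_nonpos_Reals_iff field_simps)
    from has_vector_derivative_real_field[OF this] show ?thesis by simp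
  qed
  define g where "g t = \<phi> t * exp (p * ?L t)" for t
  have "(g has_vector_derivative 0) (at t)" for t
  proof -
    have e: "((\<lambda>t. exp (p * ?L t)) has_vector_derivative (p * (- \<i> / (\<alpha> - \<i> * t))) * exp (p * ?L t)) (at t)"
      using field_vector_diff_chain_at[OF has_vector_derivative_mult_right[OF L], of exp]
      by (auto simp: comp_def intro: DERIV_exp)
    have "(g has_vector_derivative \<phi> t * ((p * (- \<i> / (\<alpha> - \<i> * t))) * exp (p * ?L t)) + \<i> * \<psi> t * exp (p * ?L t)) (at t)"
      unfolding g_def by (rule has_vector_derivative_mult[OF der e])
    moreover have nz: "\<alpha> - \<i> * t \<noteq> 0" using \<open>\<alpha> > 0\<close> by (auto simp: complex_eq_iff)
    have "\<phi> t * ((p * (- \<i> / (\<alpha> - \<i> * t))) * exp (p * ?L t)) + \<i> * \<psi> t * exp (p * ?L t) = 0"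
    proof -
      have "\<psi> t = p * \<phi> t / (\<alpha> - \<i> * t)" using eq[of t] nz by (simp add: nonzero_eq_divide_eq mult.commute)
      then show ?thesis by simp
    qed
    ultimately show ?thesis by simp
  qed
  then obtain c where "\<And>t. g t = c"
    using has_vector_derivative_zero_constant[of UNIV g] by auto
  then have "g t = g 0" by simp
  then have "\<phi> t * exp (p * ?L t) = 1" using \<open>\<phi> 0 = 1\<close> by (simp add: g_def)
  then show ?thesis by (simp add: exp_minus field_simps)
qed

section \<open>Gamma densities and the characteristic functions derived from them\<close>

lemma measurable_gamma_density [measurable]: "gamma_density \<alpha> p \<in> borel_measurable borel"
  unfolding gamma_density_def by measurable

context
  fixes \<alpha> p :: real
  assumes pos: "\<alpha> > 0" "p > 0"
begin

lemma gamma_density_nonneg: "gamma_density \<alpha> p x \<ge> 0"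
  using pos by (auto simp: gamma_density_def Gamma_real_pos)

lemma nn_integral_gamma_density: "(\<integral>\<^sup>+x. ennreal (gamma_density \<alpha> p x) \<partial>lborel) = 1"
proof -
  let ?g = "\<lambda>t. ennreal (indicator {0..} t * t powr (p - 1) / exp t)"
  \<comment> \<open>The substitution t = \<alpha> x in the Gamma integral. The factor
    \<open>Gamma p\<close> is kept, so that nothing is divided in \<open>ennreal\<close> before the
    final cancellation.\<close>
  have e: "?g (0 + \<alpha> * x) * ennreal \<alpha> = ennreal (Gamma p) * ennreal (gamma_density \<alpha> p x)" for x
  proof (cases "x > 0")
    case True
    have a: "\<alpha> powr p = \<alpha> * \<alpha> powr (p - 1)" using pos by (simp add: powr_diff)
    have G: "Gamma p > 0" using pos by (simp add: Gamma_real_pos)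
    have "Gamma p * gamma_density \<alpha> p x = (\<alpha> * x) powr (p - 1) / exp (\<alpha> * x) * \<alpha>"
      using True pos less_imp_neq[OF G] by (simp add: gamma_density_def powr_mult a exp_minus field_simps)
    then show ?thesis using True pos G
      by (simp add: ennreal_mult'[symmetric])
  next
    case False
    then have "x = 0 \<or> \<alpha> * x < 0" using pos by (auto simp: mult_less_0_iff)
    then show ?thesis using False by (auto simp: gamma_density_def)
  qed
  have "ennreal (Gamma p) = (\<integral>\<^sup>+t. ?g t \<partial>lborel)"
    by (rule Gamma_conv_nn_integral_real[OF pos(2)])
  also have "\<dots> = ennreal \<bar>\<alpha>\<bar> * (\<integral>\<^sup>+x. ?g (0 + \<alpha> * x) \<partial>lborel)"
    using pos by (intro nn_integral_real_affine) auto
  also have "\<dots> = (\<integral>\<^sup>+x. ?g (0 + \<alpha> * x) * ennreal \<alpha> \<partial>lborel)"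
    using pos by (subst nn_integral_multc) (auto simp: mult.commute)
  also have "\<dots> = ennreal (Gamma p) * (\<integral>\<^sup>+x. ennreal (gamma_density \<alpha> p x) \<partial>lborel)"
    unfolding e by (subst nn_integral_cmult) auto
  finally have *: "ennreal (Gamma p) = ennreal (Gamma p) * (\<integral>\<^sup>+x. ennreal (gamma_density \<alpha> p x) \<partial>lborel)" .
  have "ennreal (Gamma p) \<noteq> 0" "ennreal (Gamma p) \<noteq> top" using Gamma_real_pos[OF pos(2)] by auto
  with * show ?thesis by (metis ennreal_mult_cancel_left mult.right_neutral)
qed

lemma integrable_gamma_density: "integrable lborel (gamma_density \<alpha> p)"
  by (rule integrableI_nonneg) (auto simp: gamma_density_nonneg nn_integral_gamma_density)

lemma prob_space_gamma_law: "prob_space (gamma_law \<alpha> p)"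
  by (rule prob_spaceI) (auto simp: gamma_law_def emeasure_density nn_integral_gamma_density)

text \<open>Size-biasing raises the shape parameter by 1. This turns the integral of x e^(itx) into
  one against the density that \<open>gamma_density_parts\<close> compares with.\<close>

lemma gamma_density_Suc: "x * gamma_density \<alpha> p x = p / \<alpha> * gamma_density \<alpha> (p + 1) x"
proof -
  have "Gamma (p + 1) = p * Gamma p" using Gamma_plus1[of p] pos by (auto simp: nonpos_Ints_def)
  then show ?thesis
    using pos by (auto simp: gamma_density_def powr_add powr_diff field_simps)
qed

end

text \<open>Integration by parts: the difference \<open>f\<close> of the two integrands has on x > 0
  the antiderivative \<open>g\<close>, a multiple of x^p e^((it - \<alpha>) x), which tends to 0 at
  0 because p > 0 and at infinity because \<alpha> > 0.\<close>

lemma gamma_density_parts: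
  fixes \<alpha> p t :: real
  assumes "\<alpha> > 0" "p > 0"
  shows "(\<integral>x. gamma_density \<alpha> p x * iexp (t * x) \<partial>lborel) =
         (1 - \<i> * t / \<alpha>) * (\<integral>x. gamma_density \<alpha> (p + 1) x * iexp (t * x) \<partial>lborel)"
proof -
  note pos = assms
  let ?e = "\<lambda>x. iexp (t * x)"
  have int: "integrable lborel (\<lambda>x. gamma_density \<alpha> q x * ?e x)" if "q > 0" for q
  proof (rule Bochner_Integration.integrable_bound[OF integrable_gamma_density[OF pos(1) that]])
    show "(\<lambda>x. gamma_density \<alpha> q x * ?e x) \<in> borel_measurable lborel" by measurable
  qed (simp add: norm_mult del: of_real_mult)
  define f where "f x = gamma_density \<alpha> p x * ?e x - (1 - \<i> * t / \<alpha>) * (gamma_density \<alpha> (p + 1) x * ?e x)" for x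
  define g :: "real \<Rightarrow> complex" where
    "g x = of_real (\<alpha> powr p / Gamma (p + 1)) * (x powr p * exp ((\<i> * t - \<alpha>) * x))" for x
  have intf: "integrable lborel f" unfolding f_def
    using pos by (intro Bochner_Integration.integrable_diff integrable_mult_right int) auto
  have G: "Gamma (p + 1) = p * Gamma p" using Gamma_plus1[of p] pos by (auto simp: nonpos_Ints_def)
  have Gp: "Gamma p > 0" using pos by (simp add: Gamma_real_pos)
  have f_eq: "f x = of_real (\<alpha> powr p / Gamma (p + 1)) *
      (of_real (p * x powr (p - 1)) * exp ((\<i> * t - \<alpha>) * x) + x powr p * ((\<i> * t - \<alpha>) * exp ((\<i> * t - \<alpha>) * x)))" if "x > 0" for x
  proof -
    have e: "exp ((\<i> * t - \<alpha>) * x) = exp (- \<alpha> * x) * ?e x"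
      by (simp add: exp_of_real[symmetric] algebra_simps flip: exp_add)
    define c u v E where "c = \<alpha> powr p / Gamma (p + 1)" "u = p * x powr (p - 1)" "v = x powr p" "E = exp (- \<alpha> * x)"
    note defs = this
    have 1: "gamma_density \<alpha> p x = c * u * E"
      using that pos Gp by (simp add: gamma_density_def G defs)
    have 2: "gamma_density \<alpha> (p + 1) x = c * (\<alpha> * v * E)"
      using that pos by (simp add: gamma_density_def powr_add defs)
    have 3: "(1 - \<i> * t / \<alpha>) * \<alpha> = - (\<i> * t - \<alpha>)"
      using pos by (simp add: field_simps)
    have "f x = of_real c * (of_real u * (of_real E * ?e x)
        - ((1 - \<i> * t / \<alpha>) * \<alpha>) * (of_real v * (of_real E * ?e x)))"
      unfolding f_def 1 2 of_real_mult by (simp add: algebra_simps)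
    also have "\<dots> = of_real c * (of_real u * (of_real E * ?e x) + of_real v * ((\<i> * t - \<alpha>) * (of_real E * ?e x)))"
      unfolding 3 by (simp add: algebra_simps)
    finally show ?thesis unfolding e defs .
  qed
  \<comment> \<open>For p < 1 the densities are unbounded near 0, so the fundamental theorem is used
    on the open half-line, with the limits of \<open>g\<close> at both ends.\<close>
  have "(LBINT x=0..\<infinity>. f x) = 0 - 0"
  proof (rule interval_integral_FTC_integrable[where F=g])
    fix x :: real assume "0 < ereal x"
    then have x: "x > 0" by simp
    have a: "((\<lambda>x. complex_of_real (x powr p)) has_vector_derivative of_real (p * x powr (p - 1))) (at x)"
      using x by (intro has_vector_derivative_of_real) (auto intro!: derivative_eq_intros simp flip: has_real_derivative_iff_has_vector_derivative)
    have b: "((\<lambda>x. exp ((\<i> * t - \<alpha>) * x)) has_vector_derivative ((\<i> * t - \<alpha>) * exp ((\<i> * t - \<alpha>) * x))) (at x)"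
    proof -
      have "((\<lambda>z. exp ((\<i> * t - \<alpha>) * z)) has_field_derivative ((\<i> * t - \<alpha>) * exp ((\<i> * t - \<alpha>) * x))) (at (of_real x))"
        by (auto intro!: derivative_eq_intros)
      from has_vector_derivative_real_field[OF this] show ?thesis by simp
    qed
    show "(g has_vector_derivative f x) (at x)"
      unfolding f_eq[OF x] g_def
      using has_vector_derivative_mult_right[OF has_vector_derivative_mult[OF a b], of "of_real (\<alpha> powr p / Gamma (p + 1))"]
      by (simp add: algebra_simps)
    have "isCont (\<lambda>x. of_real (\<alpha> powr p / Gamma (p + 1)) *
      (of_real (p * x powr (p - 1)) * exp ((\<i> * t - \<alpha>) * x) + x powr p * ((\<i> * t - \<alpha>) * exp ((\<i> * t - \<alpha>) * x)))) x"
      using x by (intro continuous_intros) auto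
    moreover have "\<forall>\<^sub>F y in nhds x. y > 0" using eventually_nhds_in_open[of "{0<..}" x] x by simp
    ultimately show "isCont f x"
      by (subst isCont_cong[where g="\<lambda>x. of_real (\<alpha> powr p / Gamma (p + 1)) *
      (of_real (p * x powr (p - 1)) * exp ((\<i> * t - \<alpha>) * x) + x powr p * ((\<i> * t - \<alpha>) * exp ((\<i> * t - \<alpha>) * x)))"])
         (auto elim!: eventually_mono simp: f_eq)
  next
    show "set_integrable lborel (einterval 0 \<infinity>) f"
      unfolding set_integrable_def using intf by (intro integrable_mult_indicator) auto
  next
    have n: "norm (g x) = \<bar>\<alpha> powr p / Gamma (p + 1)\<bar> * (x powr p * exp (- \<alpha> * x))" for x
      by (simp add: g_def norm_mult norm_divide abs_mult)
    have "((\<lambda>x. x powr p * exp (- \<alpha> * x)) \<longlongrightarrow> 0) (at_right 0)"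
      using pos by real_asymp
    then have "(g \<longlongrightarrow> 0) (at_right 0)"
      by (subst tendsto_norm_zero_iff[symmetric], unfold n) (rule tendsto_mult_right_zero)
    then show "((g \<circ> real_of_ereal) \<longlongrightarrow> 0) (at_right 0)"
      by (simp add: zero_ereal_def ereal_tendsto_simps)
    have "((\<lambda>x. x powr p * exp (- \<alpha> * x)) \<longlongrightarrow> 0) at_top"
      using pos by real_asymp
    then have "(g \<longlongrightarrow> 0) at_top"
      by (subst tendsto_norm_zero_iff[symmetric], unfold n) (rule tendsto_mult_right_zero)
    then show "((g \<circ> real_of_ereal) \<longlongrightarrow> 0) (at_left \<infinity>)"
      by (simp add: ereal_tendsto_simps)
  qed auto
  moreover have "(LBINT x=0..\<infinity>. f x) = (\<integral>x. f x \<partial>lborel)"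
  proof -
    have "(LBINT x=0..\<infinity>. f x) = (LBINT x:{0<..}. f x)"
      by (simp add: zero_ereal_def interval_integral_to_infinity_eq)
    also have "\<dots> = (\<integral>x. f x \<partial>lborel)"
      unfolding set_lebesgue_integral_def
      by (rule Bochner_Integration.integral_cong) (auto simp: f_def gamma_density_def indicator_def)
    finally show ?thesis .
  qed
  moreover have "(\<integral>x. f x \<partial>lborel) = (\<integral>x. gamma_density \<alpha> p x * ?e x \<partial>lborel) -
      (1 - \<i> * t / \<alpha>) * (\<integral>x. gamma_density \<alpha> (p + 1) x * ?e x \<partial>lborel)"
  proof -
    have "integrable lborel (\<lambda>x. gamma_density \<alpha> p x * ?e x)" "integrable lborel (\<lambda>x. gamma_density \<alpha> (p + 1) x * ?e x)"
      using pos by (simp_all only: int add_pos_pos zero_less_one)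
    then show ?thesis
      unfolding f_def by (subst Bochner_Integration.integral_diff[OF _ integrable_mult_right]) auto
  qed
  ultimately show ?thesis by simp
qed

lemma char_gamma_law:
  assumes "\<alpha> > 0" "p > 0"
  shows "char (gamma_law \<alpha> p) t = exp (- p * Ln (1 - \<i> * of_real (t / \<alpha>)))"
proof -
  interpret prob_space "gamma_law \<alpha> p" using assms by (rule prob_space_gamma_law)
  have dens: "(\<integral>x. h x \<partial>gamma_law \<alpha> p) = (\<integral>x. gamma_density \<alpha> p x * h x \<partial>lborel)"
    if [measurable]: "h \<in> borel_measurable borel" for h :: "real \<Rightarrow> complex"
    unfolding gamma_law_def
    using assms by (subst integral_density) (auto simp: gamma_density_nonneg scaleR_conv_of_real)
  have "integrable lborel (\<lambda>x. p / \<alpha> * gamma_density \<alpha> (p + 1) x)"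
    using assms by (intro integrable_mult_right integrable_gamma_density) auto
  then have "integrable lborel (\<lambda>x. x * gamma_density \<alpha> p x)"
    unfolding gamma_density_Suc[OF assms] .
  then have X: "integrable (gamma_law \<alpha> p) (\<lambda>x. x)"
    unfolding gamma_law_def using assms
    by (subst integrable_density) (auto simp: gamma_density_nonneg mult.commute)
  let ?\<psi> = "\<lambda>t. (\<integral>x. of_real x * iexp (t * x) \<partial>gamma_law \<alpha> p)"
  show ?thesis
  proof (rule ode_powr_unique[where \<psi>="?\<psi>", OF assms(1)])
    fix t
    have "(\<integral>x. \<i> * of_real x * iexp (t * x) \<partial>gamma_law \<alpha> p) = \<i> * ?\<psi> t"
      by (subst integral_mult_right_zero[symmetric]) (simp add: mult.assoc)
    then show "(char (gamma_law \<alpha> p) has_vector_derivative \<i> * ?\<psi> t) (at t)"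
      using char_has_vector_derivative[OF finite_measure_axioms X, of t] by (simp add: char_def[abs_def])
    have 1: "?\<psi> t = p / \<alpha> * (\<integral>x. gamma_density \<alpha> (p + 1) x * iexp (t * x) \<partial>lborel)"
    proof -
      have "?\<psi> t = (\<integral>x. of_real (x * gamma_density \<alpha> p x) * iexp (t * x) \<partial>lborel)"
        by (subst dens) (auto simp: mult_ac)
      also have "\<dots> = (\<integral>x. of_real (p / \<alpha>) * (gamma_density \<alpha> (p + 1) x * iexp (t * x)) \<partial>lborel)"
        using assms by (simp add: gamma_density_Suc mult_ac)
      finally show ?thesis by simp
    qed
    have 2: "char (gamma_law \<alpha> p) t = (\<integral>x. gamma_density \<alpha> p x * iexp (t * x) \<partial>lborel)"
      unfolding char_def by (subst dens) auto
    \<comment> \<open>Both sides are multiples of the integral for shape p + 1: the left by fact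
      \<open>1\<close>, the right by the integration by parts.\<close>
    show "(\<alpha> - \<i> * t) * ?\<psi> t = p * char (gamma_law \<alpha> p) t"
      unfolding 1 2 gamma_density_parts[OF assms] using assms by (simp add: field_simps)
  next
    show "char (gamma_law \<alpha> p) 0 = 1"
      using prob_space by (simp add: char_def)
  qed
qed

lemma char_bilateral_gamma:
  assumes "\<alpha>\<^sub>1 > 0" "p\<^sub>1 > 0" "\<alpha>\<^sub>2 > 0" "p\<^sub>2 > 0"
  shows "char (bilateral_gamma \<alpha>\<^sub>1 p\<^sub>1 \<alpha>\<^sub>2 p\<^sub>2) t =
    exp (- p\<^sub>1 * Ln (1 - \<i> * of_real (t / \<alpha>\<^sub>1))) * exp (- p\<^sub>2 * Ln (1 + \<i> * of_real (t / \<alpha>\<^sub>2)))"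
proof -
  let ?M1 = "gamma_law \<alpha>\<^sub>1 p\<^sub>1" and ?M2 = "gamma_law \<alpha>\<^sub>2 p\<^sub>2"
  interpret M1: prob_space ?M1 using assms by (intro prob_space_gamma_law)
  interpret M2: prob_space ?M2 using assms by (intro prob_space_gamma_law)
  interpret pair_prob_space ?M1 ?M2 ..
  have [measurable_cong]: "sets (gamma_law \<alpha> p) = sets borel" for \<alpha> p by (simp add: gamma_law_def)
  have "char (bilateral_gamma \<alpha>\<^sub>1 p\<^sub>1 \<alpha>\<^sub>2 p\<^sub>2) t = (\<integral>z. iexp (t * (fst z - snd z)) \<partial>(?M1 \<Otimes>\<^sub>M ?M2))"
    unfolding char_def bilateral_gamma_def case_prod_beta by (subst integral_distr) auto
  also have "\<dots> = (\<integral>x. (\<integral>y. iexp (t * (x - y)) \<partial>?M2) \<partial>?M1)"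
    by (subst integral_fst'[symmetric]) (auto intro!: integrable_const_bound[of _ 1] simp del: of_real_mult)
  also have "\<dots> = (\<integral>x. iexp (t * x) * (\<integral>y. iexp (- t * y) \<partial>?M2) \<partial>?M1)"
    by (subst integral_mult_right_zero[symmetric]) (simp add: exp_add[symmetric] algebra_simps)
  also have "\<dots> = char ?M1 t * char ?M2 (- t)"
    by (simp add: char_def)
  finally show ?thesis unfolding char_gamma_law[OF assms(1,2)] char_gamma_law[OF assms(3,4)] by simp
qed

text \<open>The scheme used for the gamma law, with rate and shape 1/2, since the square has that
  gamma law. The antiderivative is now a multiple of x e^(w x^2) with w = it - 1/2; it vanishes at
  both infinities because w has real part -1/2.\<close>

lemma char_std_normal_square:
  "(\<integral>x. iexp (t * x\<^sup>2) \<partial>std_normal_distribution) = exp (- (1/2) * Ln (1 - \<i> * of_real (2 * t)))"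
proof -
  interpret real_distribution std_normal_distribution by (rule real_dist_normal_dist)
  have X: "integrable std_normal_distribution (\<lambda>x. x\<^sup>2)"
    by (rule integrable_std_normal_distribution_moment)
  let ?e = "\<lambda>t x. iexp (t * x\<^sup>2)"
  let ?\<psi> = "\<lambda>t. (\<integral>x. of_real (x\<^sup>2) * ?e t x \<partial>std_normal_distribution)"
  let ?\<phi> = "\<lambda>t. (\<integral>x. ?e t x \<partial>std_normal_distribution)"
  have parts: "(1 - 2 * \<i> * t) * ?\<psi> t = ?\<phi> t" for t
  proof -
    have i1: "integrable std_normal_distribution (?e t)"
      by (rule integrable_const_bound[of _ 1]) (auto simp del: of_real_mult of_real_power)
    have i2: "integrable std_normal_distribution (\<lambda>x. of_real (x\<^sup>2) * ?e t x)"
      by (rule Bochner_Integration.integrable_bound[OF X]) (auto simp: norm_mult simp del: of_real_mult of_real_power)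
    define h where "h x = ?e t x - (1 - 2 * \<i> * t) * (of_real (x\<^sup>2) * ?e t x)" for x
    have inth: "integrable std_normal_distribution h"
      unfolding h_def by (intro Bochner_Integration.integrable_diff integrable_mult_right i1 i2)
    have [measurable]: "h \<in> borel_measurable borel" unfolding h_def by measurable
    define f where "f x = std_normal_density x *\<^sub>R h x" for x
    define w where "w = \<i> * t - 1 / 2"
    define g :: "real \<Rightarrow> complex" where "g x = of_real (1 / sqrt (2 * pi)) * (x * exp (w * x\<^sup>2))" for x
    have intf: "integrable lborel f"
      using inth unfolding f_def by (subst (asm) integrable_density) auto
    have f_eq: "f x = of_real (1 / sqrt (2 * pi)) * (exp (w * x\<^sup>2) + x * (2 * w * x * exp (w * x\<^sup>2)))" for x
    proof -
      have e: "exp (w * x\<^sup>2) = exp (- x\<^sup>2 / 2) * ?e t x"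
        by (simp add: w_def exp_of_real[symmetric] algebra_simps flip: exp_add)
      have "f x = of_real (1 / sqrt (2 * pi)) * (exp (- x\<^sup>2 / 2) * ?e t x - (1 - 2 * \<i> * t) * (of_real (x\<^sup>2) * (exp (- x\<^sup>2 / 2) * ?e t x)))"
        unfolding f_def h_def std_normal_density_def
        by (simp add: scaleR_conv_of_real algebra_simps exp_of_real[symmetric])
      also have "\<dots> = of_real (1 / sqrt (2 * pi)) * (exp (w * x\<^sup>2) - (- 2 * w) * (of_real (x\<^sup>2) * exp (w * x\<^sup>2)))"
        unfolding e by (simp add: w_def)
      finally show ?thesis by (simp add: power2_eq_square algebra_simps)
    qed
    have "(LBINT x=-\<infinity>..\<infinity>. f x) = 0 - 0"
    proof (rule interval_integral_FTC_integrable[where F=g])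
      fix x :: real
      have "((\<lambda>z. c * (z * exp (w * z\<^sup>2))) has_field_derivative
          c * (exp (w * x\<^sup>2) + x * (2 * w * x * exp (w * x\<^sup>2)))) (at (of_real x))" for c :: complex
        by (auto intro!: derivative_eq_intros simp: algebra_simps)
      from this[of "of_real (1 / sqrt (2 * pi))"]
      have "((\<lambda>z. of_real (1 / sqrt (2 * pi)) * (z * exp (w * z\<^sup>2))) has_field_derivative f x) (at (of_real x))"
        unfolding f_eq by (simp only: of_real_power)
      from has_vector_derivative_real_field[OF this] show "(g has_vector_derivative f x) (at x)"
        by (simp add: g_def[abs_def])
      show "isCont f x" unfolding f_eq[abs_def] by (intro continuous_intros)
    next
      show "set_integrable lborel (einterval (- \<infinity>) \<infinity>) f"
        using intf by (simp add: set_integrable_def)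
    next
      have n: "norm (g x) = \<bar>1 / sqrt (2 * pi)\<bar> * (\<bar>x\<bar> * exp (- x\<^sup>2 / 2))" for x
        by (simp add: g_def norm_mult norm_divide w_def flip: of_real_power)
      have "((\<lambda>x::real. \<bar>x\<bar> * exp (- x\<^sup>2 / 2)) \<longlongrightarrow> 0) at_bot" by real_asymp
      then have "(g \<longlongrightarrow> 0) at_bot"
        by (subst tendsto_norm_zero_iff[symmetric], unfold n) (rule tendsto_mult_right_zero)
      then show "((g \<circ> real_of_ereal) \<longlongrightarrow> 0) (at_right (- \<infinity>))"
        by (simp add: ereal_tendsto_simps)
      have "((\<lambda>x::real. \<bar>x\<bar> * exp (- x\<^sup>2 / 2)) \<longlongrightarrow> 0) at_top" by real_asymp
      then have "(g \<longlongrightarrow> 0) at_top"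
        by (subst tendsto_norm_zero_iff[symmetric], unfold n) (rule tendsto_mult_right_zero)
      then show "((g \<circ> real_of_ereal) \<longlongrightarrow> 0) (at_left \<infinity>)"
        by (simp add: ereal_tendsto_simps)
    qed auto
    then have "(\<integral>x. f x \<partial>lborel) = 0"
      by (simp add: interval_lebesgue_integral_def set_lebesgue_integral_def)
    then have "(\<integral>x. h x \<partial>std_normal_distribution) = 0"
      unfolding f_def by (subst integral_density) auto
    moreover have "(\<integral>x. h x \<partial>std_normal_distribution) = ?\<phi> t - (1 - 2 * \<i> * t) * ?\<psi> t"
      unfolding h_def
      by (subst Bochner_Integration.integral_diff[OF i1 integrable_mult_right[OF i2]], subst integral_mult_right_zero) simp
    ultimately show ?thesis by simp
  qed
  have "?\<phi> t = exp (- complex_of_real (1/2) * Ln (1 - \<i> * of_real (t / (1/2))))"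
  proof (rule ode_powr_unique[where \<psi>="?\<psi>"])
    fix t
    have "(\<integral>x. \<i> * of_real (x\<^sup>2) * ?e t x \<partial>std_normal_distribution) = \<i> * ?\<psi> t"
      by (subst integral_mult_right_zero[symmetric]) (simp add: mult.assoc)
    then show "(?\<phi> has_vector_derivative \<i> * ?\<psi> t) (at t)"
      using char_has_vector_derivative[OF finite_measure_axioms X, of t] by simp
    show "(complex_of_real (1/2) - \<i> * t) * ?\<psi> t = complex_of_real (1/2) * ?\<phi> t"
      unfolding parts[of t, symmetric] by (simp add: algebra_simps)
  next
    show "?\<phi> 0 = 1" using prob_space by simp
  qed simp
  then show ?thesis by (simp add: mult.commute)
qed

section \<open>Independence via characteristic functions\<close>

text \<open>After adding a constant, \<open>V\<close> becomes a probability density, and the law of \<open>Y\<close> under it is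
  determined by its characteristic function.\<close>

lemma expectation_real_weight_eq_of_char:
  fixes V :: "'a \<Rightarrow> real" and g :: "real \<Rightarrow> complex"
  assumes "prob_space M" and Y[measurable]: "Y \<in> borel_measurable M"
    and V[measurable]: "V \<in> borel_measurable M" and V_bound: "\<And>x. \<bar>V x\<bar> \<le> B"
    and "real_distribution \<mu>"
    and charV: "\<And>t. (\<integral>x. V x * iexp (t * Y x) \<partial>M) = of_real c * char \<mu> t"
    and charY: "\<And>t. (\<integral>x. iexp (t * Y x) \<partial>M) = char \<mu> t"
    and g[measurable]: "g \<in> borel_measurable borel" and g_bound: "\<And>x. norm (g x) \<le> C"
  shows "(\<integral>x. V x * g (Y x) \<partial>M) = of_real c * (\<integral>y. g y \<partial>\<mu>)"
proof -
  interpret prob_space M by fact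
  interpret \<mu>: real_distribution \<mu> by fact
  have B: "B \<ge> 0" using V_bound[of undefined] by linarith
  have bnd: "integrable M f" if "f \<in> borel_measurable M" "\<And>x. norm (f x) \<le> D" for f :: "'a \<Rightarrow> complex" and D
    using that by (intro integrable_const_bound[of _ D]) auto
  have mult_bnd: "norm (V x * z) \<le> B * D" if "norm z \<le> D" for x and z :: complex and D
    using that V_bound[of x] B by (simp add: norm_mult mult_mono)
  have intV: "integrable M V"
    using V_bound by (intro integrable_const_bound[of _ B]) auto
  have "of_real (\<integral>x. V x \<partial>M) = of_real c * char \<mu> 0"
    using charV[of 0] by simp
  then have c: "c = (\<integral>x. V x \<partial>M)" by (simp add: \<mu>.char_zero)
  \<comment> \<open>By \<open>charV\<close> at 0, \<open>c\<close> is the mean of \<open>V\<close>,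
    so |c| \<le> B. The shift by B + 1 makes both V + K and its mean c + K at least 1, which allows
    the normalization to a density.\<close>
  define K where "K = B + 1"
  have "\<bar>c\<bar> \<le> (\<integral>x. \<bar>V x\<bar> \<partial>M)" unfolding c by (rule integral_abs_bound)
  also have "\<dots> \<le> (\<integral>x. B \<partial>M)" using intV V_bound by (intro integral_mono) auto
  finally have "\<bar>c\<bar> \<le> B" by (simp add: prob_space)
  then have cK: "c + K > 0" by (simp add: K_def)
  define D where "D x = (V x + K) / (c + K)" for x
  have [measurable]: "D \<in> borel_measurable M" unfolding D_def by measurable
  have "V x + K \<ge> 0" for x using V_bound[of x] by (simp add: K_def)
  then have D_nonneg: "D x \<ge> 0" for x using cK by (simp add: D_def)
  have intD: "integrable M D" unfolding D_def using intV by simp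
  have "(\<integral>x. D x \<partial>M) = 1"
    unfolding D_def using intV cK by (simp add: prob_space c[symmetric])
  then have "emeasure (density M D) (space M) = 1"
    using intD D_nonneg by (simp add: emeasure_density nn_integral_eq_integral cong: nn_integral_cong)
  then have "prob_space (density M D)" by (intro prob_spaceI) simp
  then interpret D: prob_space "density M D" .
  define \<nu> where "\<nu> = distr (density M D) borel Y"
  have \<nu>: "real_distribution \<nu>"
    unfolding \<nu>_def by (intro D.real_distribution_distr) simp
  have D_int: "(\<integral>x. h x \<partial>\<nu>) = ((\<integral>x. V x * h (Y x) \<partial>M) + of_real K * (\<integral>x. h (Y x) \<partial>M)) / of_real (c + K)"
    if [measurable]: "h \<in> borel_measurable borel" and h: "\<And>x. norm (h x) \<le> E" for h :: "real \<Rightarrow> complex" and E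
  proof -
    have "(\<integral>x. h x \<partial>\<nu>) = (\<integral>x. D x *\<^sub>R h (Y x) \<partial>M)"
      unfolding \<nu>_def by (subst integral_distr) (auto simp: integral_density D_nonneg)
    also have "\<dots> = (\<integral>x. (V x * h (Y x) + of_real K * h (Y x)) / of_real (c + K) \<partial>M)"
      by (simp add: D_def scaleR_conv_of_real distrib_right)
    also have "\<dots> = (\<integral>x. (V x * h (Y x) + of_real K * h (Y x)) \<partial>M) / of_real (c + K)"
      by simp
    also have "(\<integral>x. (V x * h (Y x) + of_real K * h (Y x)) \<partial>M) = (\<integral>x. V x * h (Y x) \<partial>M) + (\<integral>x. of_real K * h (Y x) \<partial>M)"
      by (intro Bochner_Integration.integral_add integrable_mult_right) (auto intro!: bnd h mult_bnd)
    finally show ?thesis by simp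
  qed
  have cK': "complex_of_real (c + K) \<noteq> 0" using cK by (metis less_irrefl of_real_eq_0_iff)
  have "char \<nu> t = char \<mu> t" for t
  proof -
    have "char \<nu> t = ((\<integral>x. V x * iexp (t * Y x) \<partial>M) + of_real K * (\<integral>x. iexp (t * Y x) \<partial>M)) / of_real (c + K)"
      unfolding char_def by (rule D_int[of _ 1]) (auto simp del: of_real_mult)
    also have "\<dots> = of_real (c + K) * char \<mu> t / of_real (c + K)"
      unfolding charV charY by (simp add: distrib_right)
    also have "\<dots> = char \<mu> t" using cK' by simp
    finally show ?thesis .
  qed
  then have 1: "\<nu> = \<mu>" using Levy_uniqueness[OF \<nu> \<open>real_distribution \<mu>\<close>] by auto
  have "char (distr M borel Y) t = (\<integral>x. iexp (t * Y x) \<partial>M)" for t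
    unfolding char_def by (subst integral_distr) auto
  then have 2: "distr M borel Y = \<mu>"
    using Levy_uniqueness[OF real_distribution_distr[OF Y] \<open>real_distribution \<mu>\<close>] charY by auto
  have "(\<integral>y. g y \<partial>\<mu>) = ((\<integral>x. V x * g (Y x) \<partial>M) + of_real K * (\<integral>y. g y \<partial>\<mu>)) / of_real (c + K)"
    using D_int[OF g g_bound] unfolding 1 by (simp add: 2[symmetric] integral_distr)
  then have "(\<integral>x. V x * g (Y x) \<partial>M) = of_real (c + K) * (\<integral>y. g y \<partial>\<mu>) - of_real K * (\<integral>y. g y \<partial>\<mu>)"
    using cK' by (simp add: nonzero_eq_divide_eq mult.commute)
  then show ?thesis by (simp add: algebra_simps)
qed

text \<open>The real and imaginary parts of \<open>U\<close> are combinations of \<open>U\<close>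
  and \<open>cnj U\<close>. The hypothesis for \<open>cnj U\<close> follows by conjugating the one
  for \<open>U\<close> at - t, because \<open>Y\<close> is real and \<open>\<mu>\<close> lives on
  the real line.\<close>

lemma expectation_weight_eq_of_char:
  fixes U :: "'a \<Rightarrow> complex" and g :: "real \<Rightarrow> complex"
  assumes "prob_space M" and Y[measurable]: "Y \<in> borel_measurable M"
    and U[measurable]: "U \<in> borel_measurable M" and U_bound: "\<And>x. norm (U x) \<le> B"
    and "real_distribution \<mu>"
    and charU: "\<And>t. (\<integral>x. U x * iexp (t * Y x) \<partial>M) = c * char \<mu> t"
    and charY: "\<And>t. (\<integral>x. iexp (t * Y x) \<partial>M) = char \<mu> t"
    and g[measurable]: "g \<in> borel_measurable borel" and g_bound: "\<And>x. norm (g x) \<le> C"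
  shows "(\<integral>x. U x * g (Y x) \<partial>M) = c * (\<integral>y. g y \<partial>\<mu>)"
proof -
  interpret prob_space M by fact
  have bnd: "integrable M f" if "f \<in> borel_measurable M" "\<And>x. norm (f x) \<le> D" for f :: "'a \<Rightarrow> complex" and D
    using that by (intro integrable_const_bound[of _ D]) auto
  have B: "B \<ge> 0" using U_bound[of undefined] norm_ge_zero order_trans by blast
  have i1: "integrable M (\<lambda>x. U x * iexp (t * Y x))" for t
    by (rule bnd[of _ B]) (auto simp: norm_mult U_bound simp del: of_real_mult)
  have [measurable]: "cnj \<in> borel_measurable borel"
    by (intro borel_measurable_continuous_onI continuous_intros)
  have i2: "integrable M (\<lambda>x. cnj (U x) * iexp (t * Y x))" for t
    by (rule bnd[of _ B]) (auto simp: norm_mult U_bound simp del: of_real_mult)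
  have char_cnj: "(\<integral>x. cnj (U x) * iexp (t * Y x) \<partial>M) = cnj c * char \<mu> t" for t
  proof -
    have "(\<integral>x. cnj (U x) * iexp (t * Y x) \<partial>M) = (\<integral>x. cnj (U x * iexp (- t * Y x)) \<partial>M)"
      by (simp add: exp_cnj)
    also have "\<dots> = cnj (c * char \<mu> (- t))"
      unfolding charU[symmetric] by (rule Bochner_Integration.integral_cnj)
    also have "\<dots> = cnj c * cnj (char \<mu> (- t))" by simp
    also have "cnj (char \<mu> (- t)) = char \<mu> t"
      unfolding char_def Bochner_Integration.integral_cnj[symmetric] by (simp add: exp_cnj)
    finally show ?thesis .
  qed
  have intg: "integrable M (\<lambda>x. h x * g (Y x))" if "h \<in> borel_measurable M" "\<And>x. norm (h x) \<le> B" for h :: "'a \<Rightarrow> complex"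
    using that B g_bound by (intro bnd[of _ "B * C"]) (auto simp: norm_mult intro!: mult_mono)
  have Re: "(\<integral>x. Re (U x) * g (Y x) \<partial>M) = of_real (Re c) * (\<integral>y. g y \<partial>\<mu>)"
  proof (rule expectation_real_weight_eq_of_char[OF \<open>prob_space M\<close> Y _ _ \<open>real_distribution \<mu>\<close> _ charY g g_bound, of _ B])
    show "\<bar>Re (U x)\<bar> \<le> B" for x using U_bound[of x] abs_Re_le_cmod order_trans by blast
    show "(\<integral>x. Re (U x) * iexp (t * Y x) \<partial>M) = of_real (Re c) * char \<mu> t" for t
    proof -
      have "(\<integral>x. Re (U x) * iexp (t * Y x) \<partial>M) = (\<integral>x. (U x * iexp (t * Y x) + cnj (U x) * iexp (t * Y x)) / 2 \<partial>M)"
        by (simp add: complex_add_cnj flip: distrib_right)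
      also have "\<dots> = (c * char \<mu> t + cnj c * char \<mu> t) / 2"
        unfolding charU[symmetric] char_cnj[symmetric]
        by (subst integral_divide_zero, subst Bochner_Integration.integral_add[OF i1 i2]) simp
      also have "\<dots> = of_real (Re c) * char \<mu> t"
        by (simp add: complex_add_cnj flip: distrib_right)
      finally show ?thesis .
    qed
  qed measurable
  have pw: "(z * w - cnj z * w) / (2 * \<i>) = Im z * w" for z w :: complex
  proof -
    have "z * w - cnj z * w = 2 * \<i> * (Im z * w)"
      by (simp add: complex_diff_cnj flip: left_diff_distrib)
    then show ?thesis
      by (metis nonzero_mult_div_cancel_left complex_i_not_zero mult_eq_0_iff zero_neq_numeral)
  qed
  have Im: "(\<integral>x. Im (U x) * g (Y x) \<partial>M) = of_real (Im c) * (\<integral>y. g y \<partial>\<mu>)"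
  proof (rule expectation_real_weight_eq_of_char[OF \<open>prob_space M\<close> Y _ _ \<open>real_distribution \<mu>\<close> _ charY g g_bound, of _ B])
    show "\<bar>Im (U x)\<bar> \<le> B" for x using U_bound[of x] abs_Im_le_cmod order_trans by blast
    show "(\<integral>x. Im (U x) * iexp (t * Y x) \<partial>M) = of_real (Im c) * char \<mu> t" for t
    proof -
      have "(\<integral>x. Im (U x) * iexp (t * Y x) \<partial>M) = (\<integral>x. (U x * iexp (t * Y x) - cnj (U x) * iexp (t * Y x)) / (2 * \<i>) \<partial>M)"
        by (simp only: pw)
      also have "\<dots> = (c * char \<mu> t - cnj c * char \<mu> t) / (2 * \<i>)"
        unfolding charU[symmetric] char_cnj[symmetric]
        by (subst integral_divide_zero, subst Bochner_Integration.integral_diff[OF i1 i2]) simp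
      also have "\<dots> = of_real (Im c) * char \<mu> t" by (rule pw)
      finally show ?thesis .
    qed
  qed measurable
  have "(\<integral>x. U x * g (Y x) \<partial>M) = (\<integral>x. (Re (U x) * g (Y x) + \<i> * (Im (U x) * g (Y x))) \<partial>M)"
    by (subst complex_eq[of "U _"]) (simp add: distrib_right mult.assoc)
  also have "\<dots> = (\<integral>x. Re (U x) * g (Y x) \<partial>M) + \<i> * (\<integral>x. Im (U x) * g (Y x) \<partial>M)"
  proof (subst Bochner_Integration.integral_add)
    show "integrable M (\<lambda>x. Re (U x) * g (Y x))"
      using U_bound abs_Re_le_cmod order_trans by (intro intg) (auto, blast)
    show "integrable M (\<lambda>x. \<i> * (Im (U x) * g (Y x)))"
      using U_bound abs_Im_le_cmod order_trans by (intro integrable_mult_right intg) (auto, blast)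
  qed simp
  also have "\<dots> = c * (\<integral>y. g y \<partial>\<mu>)"
    unfolding Re Im by (subst (3) complex_eq[of c]) (simp add: distrib_right mult.assoc)
  finally show ?thesis .
qed

text \<open>Independence as a product formula: the exponentials are replaced by the functions
  \<open>g k\<close> one index at a time, \<open>B\<close> being the indices already treated. The
  frequencies \<open>t\<close> stay arbitrary in the induction, since varying the one at the next
  index \<open>b\<close> shows that the rest \<open>U\<close> of the integrand is a weight to which
  \<open>expectation_weight_eq_of_char\<close> applies.\<close>

lemma expectation_prod_std_normal:
  fixes Y :: "'k \<Rightarrow> 'a \<Rightarrow> real" and g :: "'k \<Rightarrow> real \<Rightarrow> complex"
  assumes "prob_space M" "finite A" and Y[measurable]: "\<And>k. k \<in> A \<Longrightarrow> Y k \<in> borel_measurable M"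
    and joint: "\<And>t. (\<integral>x. iexp (\<Sum>k\<in>A. t k * Y k x) \<partial>M) = of_real (exp (- (\<Sum>k\<in>A. (t k)\<^sup>2) / 2))"
    and g[measurable]: "\<And>k. g k \<in> borel_measurable borel" and g_bound: "\<And>k x. norm (g k x) \<le> 1"
  shows "(\<integral>x. (\<Prod>k\<in>A. g k (Y k x)) \<partial>M) = (\<Prod>k\<in>A. \<integral>y. g k y \<partial>std_normal_distribution)"
proof -
  have charY: "(\<integral>x. iexp (s * Y k x) \<partial>M) = char std_normal_distribution s" if "k \<in> A" for k s
  proof -
    have "(\<Sum>j\<in>A. (if j = k then s else 0) * Y j x) = s * Y k x" for x
      using that \<open>finite A\<close> by (simp add: if_distrib[of "\<lambda>x. x * _"] sum.delta cong: if_cong)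
    moreover have "(\<Sum>j\<in>A. (if j = k then s else 0)\<^sup>2) = s\<^sup>2"
      using that \<open>finite A\<close> by (simp add: if_distrib[of "\<lambda>x. x\<^sup>2"] sum.delta cong: if_cong)
    ultimately show ?thesis
      using joint[of "\<lambda>j. if j = k then s else 0"] by (simp add: char_std_normal_distribution)
  qed
  have "finite B \<Longrightarrow> B \<subseteq> A \<Longrightarrow> (\<integral>x. iexp (\<Sum>k\<in>A - B. t k * Y k x) * (\<Prod>k\<in>B. g k (Y k x)) \<partial>M) =
      of_real (exp (- (\<Sum>k\<in>A - B. (t k)\<^sup>2) / 2)) * (\<Prod>k\<in>B. \<integral>y. g k y \<partial>std_normal_distribution)" for B t
  proof (induction B arbitrary: t rule: finite_induct)
    case empty
    then show ?case using joint by simp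
  next
    case (insert b B)
    let ?A = "A - insert b B"
    have A: "A - B = insert b ?A" and b: "b \<notin> ?A" "b \<in> A" "finite ?A" using insert \<open>finite A\<close> by auto
    define U where "U x = iexp (\<Sum>k\<in>?A. t k * Y k x) * (\<Prod>k\<in>B. g k (Y k x))" for x
    define c where "c = of_real (exp (- (\<Sum>k\<in>?A. (t k)\<^sup>2) / 2)) * (\<Prod>k\<in>B. \<integral>y. g k y \<partial>std_normal_distribution)"
    have [measurable]: "\<And>k. k \<in> B \<Longrightarrow> Y k \<in> borel_measurable M" "\<And>k. k \<in> ?A \<Longrightarrow> Y k \<in> borel_measurable M"
      "Y b \<in> borel_measurable M" using insert.prems by auto
    have Um: "U \<in> borel_measurable M" unfolding U_def by measurable
    have Ub: "norm (U x) \<le> 1" for x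
      unfolding U_def norm_mult norm_exp_i_times prod_norm[symmetric]
      by (simp add: prod_le_1 g_bound)
    have cU: "(\<integral>x. U x * iexp (s * Y b x) \<partial>M) = c * char std_normal_distribution s" for s
    proof -
      let ?t = "t(b := s)"
      have 1: "(\<Sum>k\<in>A - B. ?t k * Y k x) = s * Y b x + (\<Sum>k\<in>?A. t k * Y k x)" for x
        unfolding A using b by (subst sum.insert) (auto intro!: sum.cong)
      have 2: "(\<Sum>k\<in>A - B. (?t k)\<^sup>2) = s\<^sup>2 + (\<Sum>k\<in>?A. (t k)\<^sup>2)"
        unfolding A using b by (subst sum.insert) (auto intro!: sum.cong)
      have "(\<integral>x. U x * iexp (s * Y b x) \<partial>M) = (\<integral>x. iexp (\<Sum>k\<in>A - B. ?t k * Y k x) * (\<Prod>k\<in>B. g k (Y k x)) \<partial>M)"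
        unfolding 1 U_def by (simp add: exp_add distrib_left mult_ac)
      also have "\<dots> = of_real (exp (- (\<Sum>k\<in>A - B. (?t k)\<^sup>2) / 2)) * (\<Prod>k\<in>B. \<integral>y. g k y \<partial>std_normal_distribution)"
        using insert by auto
      also have "exp (- (\<Sum>k\<in>A - B. (?t k)\<^sup>2) / 2) = exp (- (\<Sum>k\<in>?A. (t k)\<^sup>2) / 2) * exp (- s\<^sup>2 / 2)"
        unfolding 2 exp_add[symmetric] by (simp add: field_simps)
      finally show ?thesis by (simp add: c_def char_std_normal_distribution)
    qed
    have "(\<integral>x. U x * g b (Y b x) \<partial>M) = c * (\<integral>y. g b y \<partial>std_normal_distribution)"
      using Um Ub real_dist_normal_dist cU charY[OF \<open>b \<in> A\<close>] g g_bound
      by (rule expectation_weight_eq_of_char[OF \<open>prob_space M\<close> \<open>Y b \<in> borel_measurable M\<close>])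
    then show ?case
      using insert.hyps unfolding U_def c_def by (simp add: mult_ac)
  qed
  from this[of A] \<open>finite A\<close> show ?thesis by simp
qed

section \<open>Diagonalization of symmetric tensors\<close>

lemma orthonormal_basis_of_finite_span:
  fixes S :: "'h::real_inner set"
  assumes "finite S"
  obtains Q where "finite Q" "span Q = span S" "\<And>u. u \<in> Q \<Longrightarrow> norm u = 1"
    "\<And>u v. u \<in> Q \<Longrightarrow> v \<in> Q \<Longrightarrow> u \<noteq> v \<Longrightarrow> inner u v = 0"
proof -
  from basis_orthogonal[OF assms] obtain C where C: "finite C" "span C = span S" "pairwise orthogonal C" by blast
  let ?Q = "(\<lambda>u. u /\<^sub>R norm u) ` (C - {0})"
  have "u \<in> span ?Q" if "u \<in> C" for u
  proof (cases "u = 0")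
    case False
    then have "u = norm u *\<^sub>R (u /\<^sub>R norm u)" by simp
    moreover have "u /\<^sub>R norm u \<in> ?Q" using False that by auto
    ultimately show ?thesis by (metis span_scale span_base)
  qed (simp add: span_zero)
  moreover have "v \<in> span C" if "v \<in> ?Q" for v
  proof -
    from that obtain u where "v = u /\<^sub>R norm u" "u \<in> C" by auto
    then show ?thesis by (auto simp only: intro: span_scale span_base)
  qed
  ultimately have sp: "span ?Q = span S" unfolding C(2)[symmetric] span_eq by blast
  have n: "norm u = 1" if "u \<in> ?Q" for u
  proof -
    from that obtain v where "u = v /\<^sub>R norm v" "v \<noteq> 0" by auto
    then show ?thesis by simp
  qed
  have o: "inner u v = 0" if "u \<in> ?Q" "v \<in> ?Q" "u \<noteq> v" for u v
  proof -
    from that obtain a b where ab: "u = a /\<^sub>R norm a" "v = b /\<^sub>R norm b" "a \<in> C" "b \<in> C" by auto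
    then have "a \<noteq> b" using \<open>u \<noteq> v\<close> by auto
    then show ?thesis using C(3) ab by (simp add: pairwise_def orthogonal_def)
  qed
  show ?thesis
    by (rule that[OF _ sp n o]) (use C(1) in auto)
qed

text \<open>The sphere of a finite-dimensional subspace is compact although the ambient space need not be
  locally compact.\<close>

lemma compact_cball_Int_span:
  fixes S :: "'h::real_inner set"
  assumes "finite S"
  shows "compact (cball 0 1 \<inter> span S)"
proof -
  obtain Q where Q: "finite Q" "span Q = span S" "\<And>u. u \<in> Q \<Longrightarrow> norm u = 1"
    "\<And>u v. u \<in> Q \<Longrightarrow> v \<in> Q \<Longrightarrow> u \<noteq> v \<Longrightarrow> inner u v = 0"
    using orthonormal_basis_of_finite_span[OF assms] by blast
  \<comment> \<open>In an orthonormal basis the coordinates of a vector of the unit ball lie in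
    \<open>{-1..1}\<close> by Cauchy-Schwarz. So the set in question is a closed part of the image
    of a cube, which is built one coordinate at a time.\<close>
  have "compact {\<Sum>u\<in>A. c u *\<^sub>R u | c. \<forall>u\<in>A. c u \<in> {-1..1}}" if "finite A" for A :: "'h set"
    using that
  proof induction
    case empty
    then show ?case by simp
  next
    case (insert a A)
    let ?K = "{\<Sum>u\<in>A. c u *\<^sub>R u | c. \<forall>u\<in>A. c u \<in> {-1..1::real}}"
    have "{\<Sum>u\<in>insert a A. c u *\<^sub>R u | c. \<forall>u\<in>insert a A. c u \<in> {-1..1}} = (\<lambda>(t, x). t *\<^sub>R a + x) ` ({-1..1} \<times> ?K)"
    proof (intro equalityI subsetI)
      fix y assume "y \<in> {\<Sum>u\<in>insert a A. c u *\<^sub>R u | c. \<forall>u\<in>insert a A. c u \<in> {-1..1}}"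
      then obtain c where "y = (\<Sum>u\<in>insert a A. c u *\<^sub>R u)" "\<forall>u\<in>insert a A. c u \<in> {-1..1}" by blast
      then show "y \<in> (\<lambda>(t, x). t *\<^sub>R a + x) ` ({-1..1} \<times> ?K)"
        using insert.hyps by (intro image_eqI[of _ _ "(c a, \<Sum>u\<in>A. c u *\<^sub>R u)"]) auto
    next
      fix y assume "y \<in> (\<lambda>(t, x). t *\<^sub>R a + x) ` ({-1..1} \<times> ?K)"
      then obtain t c where y: "t \<in> {-1..1}" "\<forall>u\<in>A. c u \<in> {-1..1}" "y = t *\<^sub>R a + (\<Sum>u\<in>A. c u *\<^sub>R u)" by auto
      have "(\<Sum>u\<in>A. (c(a := t)) u *\<^sub>R u) = (\<Sum>u\<in>A. c u *\<^sub>R u)"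
        using insert.hyps by (intro sum.cong) auto
      then have "y = (\<Sum>u\<in>insert a A. (c(a := t)) u *\<^sub>R u)" "\<forall>u\<in>insert a A. (c(a := t)) u \<in> {-1..1}"
        using y insert.hyps by auto
      then show "y \<in> {\<Sum>u\<in>insert a A. c u *\<^sub>R u | c. \<forall>u\<in>insert a A. c u \<in> {-1..1}}" by blast
    qed
    moreover have "continuous_on ({-1..1} \<times> ?K) (\<lambda>(t, x). t *\<^sub>R a + x)"
      unfolding case_prod_beta by (intro continuous_intros)
    moreover have "compact ({-1..1::real} \<times> ?K)" by (intro compact_Times compact_Icc insert.IH)
    ultimately show ?case by (simp only: compact_continuous_image)
  qed
  from this[OF \<open>finite Q\<close>] have K: "compact (cball 0 1 \<inter> {\<Sum>u\<in>Q. c u *\<^sub>R u | c. \<forall>u\<in>Q. c u \<in> {-1..1}})"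
    by (intro closed_Int_compact) auto
  have "cball 0 1 \<inter> span S = cball 0 1 \<inter> {\<Sum>u\<in>Q. c u *\<^sub>R u | c. \<forall>u\<in>Q. c u \<in> {-1..1}}"
  proof (intro equalityI subsetI IntI)
    fix x assume x: "x \<in> cball 0 1 \<inter> span S"
    then have "x \<in> span Q" using Q(2) by simp
    then obtain c where c: "x = (\<Sum>u\<in>Q. c u *\<^sub>R u)" unfolding span_finite[OF Q(1)] by blast
    have "c v \<in> {-1..1}" if "v \<in> Q" for v
    proof -
      have "inner x v = (\<Sum>u\<in>Q. if u = v then c u else 0)"
        unfolding c inner_sum_left using Q(3,4) that
        by (intro sum.cong) (auto simp: dot_square_norm)
      then have "inner x v = c v" using that Q(1) by simp
      moreover have "\<bar>inner x v\<bar> \<le> norm x * norm v" by (rule Cauchy_Schwarz_ineq2)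
      ultimately show ?thesis using x Q(3)[OF that] by auto
    qed
    with c show "x \<in> {\<Sum>u\<in>Q. c u *\<^sub>R u | c. \<forall>u\<in>Q. c u \<in> {-1..1}}" by blast
  next
    fix x assume "x \<in> cball 0 1 \<inter> {\<Sum>u\<in>Q. c u *\<^sub>R u | c. \<forall>u\<in>Q. c u \<in> {-1..1}}"
    then obtain c where "x = (\<Sum>u\<in>Q. c u *\<^sub>R u)" by blast
    then show "x \<in> span S" unfolding Q(2)[symmetric] by (auto intro!: span_sum intro: span_scale span_base)
  qed auto
  with K show ?thesis by simp
qed

definition orthonormal :: "'h::real_inner set \<Rightarrow> bool" where
  "orthonormal A \<longleftrightarrow> (\<forall>u\<in>A. norm u = 1) \<and> (\<forall>u\<in>A. \<forall>v\<in>A. u \<noteq> v \<longrightarrow> inner u v = 0)"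

lemma orthonormal_card_le:
  assumes "orthonormal A" "A \<subseteq> span S" "finite S"
  shows "finite A \<and> card A \<le> card S"
proof -
  have "pairwise orthogonal A" "0 \<notin> A"
    using assms(1) by (auto simp: orthonormal_def pairwise_def orthogonal_def)
  then have "independent A" by (rule pairwise_orthogonal_independent)
  then show ?thesis using independent_span_bound[OF \<open>finite S\<close>] assms by auto
qed

text \<open>A maximal orthonormal set of eigenvectors spans: otherwise the Rayleigh quotient on its
  orthogonal complement would attain a maximum at a further eigenvector.\<close>

lemma exists_orthonormal_diagonalizing:
  fixes B :: "'h::real_inner \<Rightarrow> 'h \<Rightarrow> real"
  assumes "finite S" and B: "bounded_bilinear B" and sym: "\<And>u v. B u v = B v u"
  obtains A where "finite A" "orthonormal A" "span A = span S"
    "\<And>u v. u \<in> A \<Longrightarrow> v \<in> A \<Longrightarrow> u \<noteq> v \<Longrightarrow> B u v = 0"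
proof -
  interpret B: bounded_bilinear B by fact
  \<comment> \<open>The last clause says that \<open>u\<close> is an eigenvector of the operator
    representing \<open>B\<close> on \<open>span S\<close>, without naming that operator.\<close>
  define good where "good A \<longleftrightarrow> orthonormal A \<and> A \<subseteq> span S \<and>
    (\<forall>u\<in>A. \<forall>w\<in>span S. inner u w = 0 \<longrightarrow> B u w = 0)" for A
  have good_card: "finite A" "card A \<le> card S" if "good A" for A
    using orthonormal_card_le[of A S] that \<open>finite S\<close> by (auto simp: good_def)
  have "good {}" by (simp add: good_def orthonormal_def)
  then obtain A where A: "good A" and max: "\<And>A'. good A' \<Longrightarrow> card A' \<le> card A"
    using ex_has_greatest_nat[of good "{}" card "Suc (card S)"] good_card by (meson le_imp_less_Suc)
  have finA: "finite A" using good_card A by auto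
  have nA: "\<And>u. u \<in> A \<Longrightarrow> norm u = 1" and oA: "\<And>u v. u \<in> A \<Longrightarrow> v \<in> A \<Longrightarrow> u \<noteq> v \<Longrightarrow> inner u v = 0"
    and sA: "\<And>u. u \<in> A \<Longrightarrow> u \<in> span S" and eA: "\<And>u w. u \<in> A \<Longrightarrow> w \<in> span S \<Longrightarrow> inner u w = 0 \<Longrightarrow> B u w = 0"
    using A by (auto simp: good_def orthonormal_def)
  define proj where "proj w = (\<Sum>u\<in>A. inner u w *\<^sub>R u)" for w
  have inner_proj: "inner u (w - proj w) = 0" if "u \<in> A" for u w
  proof -
    have "inner u (proj w) = (\<Sum>v\<in>A. if v = u then inner v w else 0)"
      unfolding proj_def inner_sum_right using nA oA that
      by (intro sum.cong) (auto simp: dot_square_norm)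
    also have "\<dots> = inner u w" using finA that by simp
    finally show ?thesis by (simp add: inner_diff_right)
  qed
  have proj_span: "w - proj w \<in> span S" if "w \<in> span S" for w
    unfolding proj_def using that sA by (intro span_diff span_sum span_scale) auto
  have complete: "w = 0" if w: "w \<in> span S" "\<And>u. u \<in> A \<Longrightarrow> inner u w = 0" for w
  proof (rule ccontr)
    assume "w \<noteq> 0"
    define K where "K = (cball 0 1 \<inter> span S) \<inter> ({x. norm x = 1} \<inter> (\<Inter>u\<in>A. {x. inner u x = 0}))"
    have "closed ({x. norm x = 1} \<inter> (\<Inter>u\<in>A. {x::'h. inner u x = 0}))"
      by (intro closed_Int closed_INT ballI closed_Collect_eq continuous_intros)
    then have "compact K"
      unfolding K_def by (intro compact_Int_closed compact_cball_Int_span \<open>finite S\<close>)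
    have "w /\<^sub>R norm w \<in> K"
      using w \<open>w \<noteq> 0\<close> by (auto simp: K_def intro: span_scale)
    then have "K \<noteq> {}" by auto
    moreover have "continuous_on K (\<lambda>x. B x x)"
      by (intro B.continuous_on continuous_intros)
    ultimately obtain e where e: "e \<in> K" and emax: "\<And>x. x \<in> K \<Longrightarrow> B x x \<le> B e e"
      using continuous_attains_sup[OF \<open>compact K\<close>] by blast
    have e': "norm e = 1" "e \<in> span S" "\<And>u. u \<in> A \<Longrightarrow> inner u e = 0" using e by (auto simp: K_def)
    have quad: "B x x \<le> B e e * (norm x)\<^sup>2" if "x \<in> span S" "\<And>u. u \<in> A \<Longrightarrow> inner u x = 0" for x
    proof (cases "x = 0")
      case False
      then have "x /\<^sub>R norm x \<in> K" using that by (auto simp: K_def intro: span_scale)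
      moreover have "B (x /\<^sub>R norm x) (x /\<^sub>R norm x) = B x x / (norm x)\<^sup>2"
        by (simp add: B.scaleR_left B.scaleR_right power2_eq_square divide_inverse)
      ultimately have "B x x / (norm x)\<^sup>2 \<le> B e e" using emax by metis
      then show ?thesis using False by (simp add: divide_le_eq)
    qed (simp add: B.zero_left)
    have ew: "B e v = 0" if v: "v \<in> span S" "\<And>u. u \<in> A \<Longrightarrow> inner u v = 0" "inner e v = 0" for v
    proof -
      \<comment> \<open>This is \<open>quad\<close> at \<open>e + s v\<close>. The left side is
        linear in s and the right side quadratic, which forces \<open>B e v\<close> to
        vanish.\<close>
      have ineq: "2 * s * B e v \<le> s\<^sup>2 * (B e e * (norm v)\<^sup>2 - B v v)" for s
      proof -
        have n: "(norm (e + s *\<^sub>R v))\<^sup>2 = 1 + s\<^sup>2 * (norm v)\<^sup>2"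
        proof -
          have "inner e e = 1" using e'(1) by (simp add: dot_square_norm)
          then show ?thesis using v(3)
            unfolding power2_norm_eq_inner by (simp add: inner_add inner_commute[of v e] power2_eq_square)
        qed
        have b: "B (e + s *\<^sub>R v) (e + s *\<^sub>R v) = B e e + 2 * s * B e v + s\<^sup>2 * B v v"
          by (simp add: B.add_left B.add_right B.scaleR_left B.scaleR_right sym[of v e] power2_eq_square algebra_simps)
        have "B (e + s *\<^sub>R v) (e + s *\<^sub>R v) \<le> B e e * (norm (e + s *\<^sub>R v))\<^sup>2"
          using v e' by (intro quad) (auto intro!: span_add span_scale simp: inner_add_right)
        then show ?thesis unfolding n b by (simp add: algebra_simps)
      qed
      \<comment> \<open>With s = B e v / C the inequality yields 2 q \<le> q for q = (B e v)^2 / C,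
        hence q \<le> 0. Adding 1 makes \<open>C\<close> positive.\<close>
      define C where "C = \<bar>B e e * (norm v)\<^sup>2 - B v v\<bar> + 1"
      have "C > 0" by (simp add: C_def)
      have "2 * (B e v / C) * B e v \<le> (B e v / C)\<^sup>2 * C"
        by (rule order_trans[OF ineq]) (auto intro!: mult_left_mono simp: C_def)
      then have "(B e v)\<^sup>2 / C \<le> 0" using \<open>C > 0\<close> by (simp add: power2_eq_square field_simps)
      then show ?thesis using \<open>C > 0\<close> by (simp add: divide_le_0_iff)
    qed
    have "e \<notin> A" using e' by (metis inner_eq_zero_iff norm_zero zero_neq_one)
    have "good (insert e A)"
      unfolding good_def
    proof (intro conjI ballI impI)
      show "orthonormal (insert e A)"
        using e' nA oA by (auto simp: orthonormal_def inner_commute)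
      show "insert e A \<subseteq> span S" using e' sA by auto
      fix u x assume u: "u \<in> insert e A" and x: "x \<in> span S" "inner u x = 0"
      show "B u x = 0"
      proof (cases "u \<in> A")
        case True then show ?thesis using eA x by auto
      next
        case False
        then have [simp]: "u = e" using u by auto
        \<comment> \<open>The vector \<open>x\<close> is split at its projection. The projected part
          is killed by symmetry, as the members of \<open>A\<close> are eigenvectors orthogonal to
          \<open>e\<close>; the rest is orthogonal to \<open>A\<close> and to \<open>e\<close>, and
          \<open>ew\<close> applies.\<close>
        have "B e v = 0" if "v \<in> A" for v
          using eA[OF that e'(2) e'(3)[OF that]] sym by simp
        then have "B e (proj x) = 0" by (simp add: proj_def B.sum_right B.scaleR_right)
        moreover have "B e (x - proj x) = 0"
        proof (rule ew)
          have "inner e (proj x) = 0"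
            using e'(3) by (simp add: proj_def inner_sum_right inner_commute[of e])
          then show "inner e (x - proj x) = 0" using x by (simp add: inner_diff_right)
        qed (use inner_proj proj_span x in auto)
        ultimately show ?thesis by (simp add: B.diff_right)
      qed
    qed
    from max[OF this] show False using \<open>e \<notin> A\<close> finA by simp
  qed
  have "span A = span S"
  proof (intro antisym subsetI)
    fix x assume "x \<in> span S"
    then have "x - proj x = 0" using complete[of "x - proj x"] proj_span inner_proj by auto
    moreover have "proj x \<in> span A" unfolding proj_def by (intro span_sum span_scale span_base)
    ultimately show "x \<in> span A" by simp
  next
    fix x assume "x \<in> span A" then show "x \<in> span S" using sA span_minimal[of A "span S"] by auto
  qed
  moreover have "orthonormal A" using A by (simp add: good_def)
  ultimately show ?thesis using that finA oA eA sA by metis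
qed

text \<open>The form B u v = <f, u (x) v> is symmetric because \<open>f\<close> is, and it is
  diagonalized on the span of the finitely many vectors occurring in \<open>f\<close>. The
  difference of \<open>f\<close> and the diagonal tensor \<open>g\<close> lies in the span of the
  products of basis vectors and is orthogonal to each of them, so it is 0.\<close>

lemma symmetric_tensor_diagonal:
  fixes tens :: "'h::real_inner \<Rightarrow> 'h \<Rightarrow> 't::real_inner"
  assumes "hilbert_tensor_square tens" and f: "f \<in> span {tens a b + tens b a | a b. True}"
  obtains A l where "finite A" "orthonormal A" "f = (\<Sum>u\<in>A. l u *\<^sub>R tens u u)" "(norm f)\<^sup>2 = (\<Sum>u\<in>A. (l u)\<^sup>2)"
proof -
  have bil: "bilinear tens" and ip: "\<And>a b c d. inner (tens a b) (tens c d) = inner a c * inner b d"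
    using assms by (auto simp: hilbert_tensor_square_def)
  have norm_tens: "norm (tens a b) = norm a * norm b" for a b
    by (simp add: norm_eq_sqrt_inner ip real_sqrt_mult)
  have lin: "linear (tens a)" "linear (\<lambda>a. tens a b)" for a b using bil by (auto simp: bilinear_def)
  from f obtain T r where T: "finite T" "T \<subseteq> {tens a b + tens b a | a b. True}" "f = (\<Sum>x\<in>T. r x *\<^sub>R x)"
    by (auto simp: span_explicit)
  then have "\<forall>x\<in>T. \<exists>a b. x = tens a b + tens b a" by auto
  then obtain a b where ab: "\<And>x. x \<in> T \<Longrightarrow> x = tens (a x) (b x) + tens (b x) (a x)" by metis
  define S where "S = a ` T \<union> b ` T"
  have finS: "finite S" using T by (simp add: S_def)
  define B where "B u v = inner f (tens u v)" for u v
  have "bounded_bilinear B"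
  proof
    show "\<exists>K. \<forall>u v. norm (B u v) \<le> norm u * norm v * K"
      using Cauchy_Schwarz_ineq2[of f "tens _ _"] unfolding B_def norm_tens
      by (intro exI[of _ "norm f"]) (auto simp: mult_ac)
  qed (simp_all add: B_def linear_add[OF lin(1)] linear_add[OF lin(2)] linear_scale[OF lin(1)] linear_scale[OF lin(2)] inner_add_right)
  moreover have "B u v = B v u" for u v
  proof -
    have "inner x (tens u v) = inner x (tens v u)" if "x \<in> T" for x
      by (subst (1 2) ab[OF that]) (simp add: inner_add_left ip)
    then show ?thesis unfolding B_def T(3) inner_sum_left by simp
  qed
  ultimately obtain A where A: "finite A" "orthonormal A" "span A = span S"
    and diag: "\<And>u v. u \<in> A \<Longrightarrow> v \<in> A \<Longrightarrow> u \<noteq> v \<Longrightarrow> B u v = 0"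
    using exists_orthonormal_diagonalizing[OF finS] by metis
  have oA: "inner u v = (if u = v then 1 else 0)" if "u \<in> A" "v \<in> A" for u v
    using A(2) that by (auto simp: orthonormal_def dot_square_norm)
  define l where "l u = B u u" for u
  define g where "g = (\<Sum>u\<in>A. l u *\<^sub>R tens u u)"
  let ?P = "span {tens u v | u v. u \<in> A \<and> v \<in> A}"
  have ten_in: "tens x y \<in> ?P" if "x \<in> span A" "y \<in> span A" for x y
  proof -
    obtain c d where "x = (\<Sum>u\<in>A. c u *\<^sub>R u)" "y = (\<Sum>v\<in>A. d v *\<^sub>R v)"
      using \<open>x \<in> span A\<close> \<open>y \<in> span A\<close> unfolding span_finite[OF \<open>finite A\<close>] by blast
    have *: "tens u y = (\<Sum>v\<in>A. d v *\<^sub>R tens u v)" for u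
      unfolding \<open>y = _\<close> by (simp add: linear_sum[OF lin(1)] linear_scale[OF lin(1)])
    have "tens x y = (\<Sum>u\<in>A. c u *\<^sub>R tens u y)"
      unfolding \<open>x = _\<close> by (simp add: linear_sum[OF lin(2)] linear_scale[OF lin(2)])
    also have "\<dots> = (\<Sum>u\<in>A. c u *\<^sub>R (\<Sum>v\<in>A. d v *\<^sub>R tens u v))"
      by (simp only: *)
    also have "\<dots> \<in> ?P" by (intro span_sum span_scale span_base) auto
    finally show ?thesis .
  qed
  have ab_in: "a x \<in> span A" "b x \<in> span A" if "x \<in> T" for x
    using that unfolding A(3) by (auto simp: S_def intro!: span_base)
  have "f \<in> ?P"
    unfolding T(3)
  proof (intro span_sum span_scale)
    fix x assume "x \<in> T"
    then have "tens (a x) (b x) + tens (b x) (a x) \<in> ?P" by (intro span_add ten_in ab_in)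
    then show "x \<in> ?P" using ab[OF \<open>x \<in> T\<close>] by simp
  qed
  moreover have "g \<in> ?P" unfolding g_def by (intro span_sum span_scale span_base) auto
  ultimately have "f - g \<in> ?P" by (rule span_diff)
  moreover have gin: "inner g (tens u v) = (if u = v then l u else 0)" if "u \<in> A" "v \<in> A" for u v
  proof -
    have "inner g (tens u v) = (\<Sum>w\<in>A. if w = u then (if u = v then l u else 0) else 0)"
      unfolding g_def inner_sum_left using that by (intro sum.cong) (auto simp: ip oA)
    then show ?thesis using that A(1) by simp
  qed
  have "orthogonal (f - g) x" if "x \<in> {tens u v | u v. u \<in> A \<and> v \<in> A}" for x
  proof -
    from that obtain u v where x: "x = tens u v" "u \<in> A" "v \<in> A" by auto
    then show ?thesis using diag[of u v] gin[of u v] by (auto simp: orthogonal_def inner_diff_left B_def l_def)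
  qed
  ultimately have "orthogonal (f - g) (f - g)" by (intro orthogonal_to_span[of "f - g"])
  then have fg: "f = g" by (simp add: orthogonal_def)
  have "inner g g = (\<Sum>u\<in>A. l u * inner g (tens u u))"
    by (subst (2) g_def) (simp add: inner_sum_right)
  also have "\<dots> = (\<Sum>u\<in>A. (l u)\<^sup>2)" by (intro sum.cong) (auto simp: gin power2_eq_square)
  finally have "(norm f)\<^sup>2 = (\<Sum>u\<in>A. (l u)\<^sup>2)" unfolding fg by (simp add: power2_norm_eq_inner)
  with A fg show ?thesis unfolding g_def by (intro that[of A l]) auto
qed

section \<open>The second Wiener chaos\<close>

text \<open>The two cases of \<open>centered_gaussian\<close> share one formula, the degenerate case
  having variance 0; a nondegenerate variable is rescaled to the standard normal law.\<close>

lemma centered_gaussian_char: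
  assumes "prob_space M" "centered_gaussian M Y"
  shows "Y \<in> borel_measurable M" "integrable M (\<lambda>x. (Y x)\<^sup>2)"
    "(\<integral>x. iexp (Y x) \<partial>M) = of_real (exp (- (\<integral>x. (Y x)\<^sup>2 \<partial>M) / 2))"
proof -
  interpret prob_space M by fact
  show Y[measurable]: "Y \<in> borel_measurable M" using assms by (simp add: centered_gaussian_def)
  consider "AE x in M. Y x = 0" | \<sigma> where "\<sigma> > 0" "distributed M lborel Y (normal_density 0 \<sigma>)"
    using assms by (auto simp: centered_gaussian_def)
  then have "integrable M (\<lambda>x. (Y x)\<^sup>2) \<and>
    (\<integral>x. iexp (Y x) \<partial>M) = of_real (exp (- (\<integral>x. (Y x)\<^sup>2 \<partial>M) / 2))"
  proof cases
    case 1
    have "integrable M (\<lambda>x. (Y x)\<^sup>2) \<longleftrightarrow> integrable M (\<lambda>x. 0::real)"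
      using 1 by (intro integrable_cong_AE) auto
    moreover have "(\<integral>x. (Y x)\<^sup>2 \<partial>M) = (\<integral>x. 0 \<partial>M)"
      using 1 by (intro integral_cong_AE) auto
    moreover have "(\<integral>x. iexp (Y x) \<partial>M) = (\<integral>x. 1 \<partial>M)"
      using 1 by (intro integral_cong_AE) auto
    ultimately show ?thesis by (simp add: prob_space)
  next
    case 2
    define Z where "Z x = Y x / \<sigma>" for x
    have YZ: "Y = (\<lambda>x. \<sigma> * Z x)" using 2 by (auto simp: Z_def)
    have [measurable]: "Z \<in> borel_measurable M" unfolding Z_def by measurable
    have "distributed M lborel Z std_normal_density"
      using normal_standard_normal_convert[of \<sigma> Y 0] 2 by (simp add: Z_def[abs_def])
    then have "distr M lborel Z = std_normal_distribution" by (simp add: distributed_def)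
    then have d: "distr M borel Z = std_normal_distribution"
      by (metis distr_cong sets_lborel)
    have "integrable (distr M borel Z) (\<lambda>x. x\<^sup>2)" "(\<integral>x. x\<^sup>2 \<partial>distr M borel Z) = 1"
      unfolding d using std_normal_distribution_even_moments[of 1]
      by (simp_all add: fact_numeral)
    then have "integrable M (\<lambda>x. (Z x)\<^sup>2)" "(\<integral>x. (Z x)\<^sup>2 \<partial>M) = 1"
      by (simp_all add: integral_distr integrable_distr_eq)
    moreover have "(\<integral>x. iexp (\<sigma> * Z x) \<partial>M) = char (distr M borel Z) \<sigma>"
      unfolding char_def by (subst integral_distr) auto
    ultimately show ?thesis
      unfolding YZ d char_std_normal_distribution by (simp add: power_mult_distrib)
  qed
  then show "integrable M (\<lambda>x. (Y x)\<^sup>2)"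
    "(\<integral>x. iexp (Y x) \<partial>M) = of_real (exp (- (\<integral>x. (Y x)\<^sup>2 \<partial>M) / 2))" by auto
qed

lemma integrable_mult_of_squares:
  fixes X Y :: "'a \<Rightarrow> real"
  assumes [measurable]: "X \<in> borel_measurable M" "Y \<in> borel_measurable M"
    and "integrable M (\<lambda>x. (X x)\<^sup>2)" "integrable M (\<lambda>x. (Y x)\<^sup>2)"
  shows "integrable M (\<lambda>x. X x * Y x)"
proof (rule Bochner_Integration.integrable_bound)
  show "integrable M (\<lambda>x. (X x)\<^sup>2 + (Y x)\<^sup>2)" using assms by simp
  have "\<bar>a * b\<bar> \<le> a\<^sup>2 + b\<^sup>2" for a b :: real
  proof -
    have "2 * \<bar>a * b\<bar> \<le> a\<^sup>2 + b\<^sup>2"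
      using sum_squares_bound[of "\<bar>a\<bar>" "\<bar>b\<bar>"] by (simp add: abs_mult mult.assoc)
    then show ?thesis using abs_ge_zero[of "a * b"] by linarith
  qed
  then show "AE x in M. norm (X x * Y x) \<le> norm ((X x)\<^sup>2 + (Y x)\<^sup>2)" by simp
qed measurable

lemma isonormal_gaussian:
  assumes "isonormal_process M W" "finite F"
  shows "centered_gaussian M (\<lambda>x. \<Sum>h\<in>F. a h * W h x)"
  using assms by (simp add: isonormal_process_def)

text \<open>By joint Gaussianity the linear combination is a single centred Gaussian variable, and
  orthonormality reduces its variance to the sum of squares. This is the \<open>joint\<close>
  hypothesis of \<open>expectation_prod_std_normal\<close>.\<close>

lemma isonormal_joint_char:
  assumes "isonormal_process M W" "finite A" "orthonormal A"
  shows "(\<integral>x. iexp (\<Sum>u\<in>A. t u * W u x) \<partial>M) = of_real (exp (- (\<Sum>u\<in>A. (t u)\<^sup>2) / 2))"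
proof -
  interpret prob_space M using assms by (simp add: isonormal_process_def)
  note gauss = isonormal_gaussian[OF assms(1)]
  have cov: "(\<integral>x. W g x * W h x \<partial>M) = inner g h" for g h
    using assms by (auto simp: isonormal_process_def)
  have "centered_gaussian M (W h)" for h
    using gauss[of "{h}" "\<lambda>_. 1"] by simp
  from centered_gaussian_char(1,2)[OF prob_space_axioms this]
  have int: "integrable M (\<lambda>x. W g x * W h x)" for g h
    by (intro integrable_mult_of_squares)
  have "(\<integral>x. (\<Sum>u\<in>A. t u * W u x)\<^sup>2 \<partial>M) = (\<integral>x. (\<Sum>u\<in>A. \<Sum>v\<in>A. (t u * t v) * (W u x * W v x)) \<partial>M)"
    by (simp add: power2_eq_square sum_product mult_ac)
  also have "\<dots> = (\<Sum>u\<in>A. \<Sum>v\<in>A. (t u * t v) * inner u v)"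
    using int by (simp add: Bochner_Integration.integral_sum cov)
  also have "\<dots> = (\<Sum>u\<in>A. \<Sum>v\<in>A. if u = v then (t u)\<^sup>2 else 0)"
    using assms(3) by (intro sum.cong) (auto simp: orthonormal_def dot_square_norm power2_eq_square)
  also have "\<dots> = (\<Sum>u\<in>A. (t u)\<^sup>2)"
    using assms(2) by simp
  finally show ?thesis
    using centered_gaussian_char(3)[OF prob_space_axioms gauss[OF assms(2)], of t] by simp
qed

text \<open>The exponential factors over \<open>A\<close> into functions of the separate variables
  \<open>W u\<close>. The parameter is 2 l because \<open>chi2_cgf x\<close> belongs to x (N^2 - 1)
  / 2.\<close>

lemma isonormal_chi2_char:
  assumes W: "isonormal_process M W" and A: "finite A" "orthonormal A"
  shows "(\<integral>x. iexp (t * (\<Sum>u\<in>A. l u * ((W u x)\<^sup>2 - 1))) \<partial>M) = exp (\<Sum>u\<in>A. chi2_cgf (2 * l u) t)"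
proof -
  interpret prob_space M using W by (simp add: isonormal_process_def)
  have "centered_gaussian M (W h)" for h
    using isonormal_gaussian[OF W, of "{h}" "\<lambda>_. 1"] by simp
  from centered_gaussian_char(1)[OF prob_space_axioms this]
  have [measurable]: "W h \<in> borel_measurable M" for h .
  define g where "g u y = iexp (t * (l u * (y\<^sup>2 - 1)))" for u y
  have "(\<integral>x. iexp (t * (\<Sum>u\<in>A. l u * ((W u x)\<^sup>2 - 1))) \<partial>M) = (\<integral>x. (\<Prod>u\<in>A. g u (W u x)) \<partial>M)"
    unfolding g_def by (simp add: exp_sum[OF A(1), symmetric] sum_distrib_left)
  also have "\<dots> = (\<Prod>u\<in>A. \<integral>y. g u y \<partial>std_normal_distribution)"
    by (rule expectation_prod_std_normal[OF prob_space_axioms A(1) _ isonormal_joint_char[OF W A]])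
       (auto simp: g_def simp del: of_real_mult)
  also have "\<dots> = (\<Prod>u\<in>A. exp (chi2_cgf (2 * l u) t))"
  proof (rule prod.cong[OF refl])
    fix u
    have "(\<integral>y. g u y \<partial>std_normal_distribution) = (\<integral>y. iexp (t * l u * y\<^sup>2) * iexp (- t * l u) \<partial>std_normal_distribution)"
      unfolding g_def by (simp add: exp_add[symmetric] algebra_simps)
    also have "\<dots> = exp (- (1/2) * Ln (1 - \<i> * of_real (2 * (t * l u)))) * iexp (- t * l u)"
      by (subst integral_mult_left_zero) (simp only: char_std_normal_square)
    also have "\<dots> = exp (chi2_cgf (2 * l u) t)"
    proof -
      have "- (1/2) * L + \<i> * of_real (- t * l u) = (- L - \<i> * of_real (2 * l u) * t) / 2" for L :: complex
        by (simp add: field_simps)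
      moreover have "\<i> * of_real (2 * (t * l u)) = \<i> * of_real (2 * l u) * of_real t"
        by simp
      ultimately show ?thesis
        unfolding exp_add[symmetric] chi2_cgf_def by (simp only:)
    qed
    finally show "(\<integral>y. g u y \<partial>std_normal_distribution) = exp (chi2_cgf (2 * l u) t)" .
  qed
  finally show ?thesis by (simp add: exp_sum[OF A(1)])
qed

lemma (in prob_space) expectation_abs_le_sqrt:
  assumes [measurable]: "Z \<in> borel_measurable M" and Z: "integrable M (\<lambda>x. (Z x)\<^sup>2)"
  shows "integrable M Z" "expectation (\<lambda>x. \<bar>Z x\<bar>) \<le> sqrt (expectation (\<lambda>x. (Z x)\<^sup>2))"
proof -
  show i: "integrable M Z" by (rule square_integrable_imp_integrable) (use Z in auto)
  have "0 \<le> variance (\<lambda>x. \<bar>Z x\<bar>)" by (rule variance_positive)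
  also have "\<dots> = expectation (\<lambda>x. \<bar>Z x\<bar>\<^sup>2) - (expectation (\<lambda>x. \<bar>Z x\<bar>))\<^sup>2"
    using i Z by (intro variance_eq) auto
  finally show "expectation (\<lambda>x. \<bar>Z x\<bar>) \<le> sqrt (expectation (\<lambda>x. (Z x)\<^sup>2))"
    by (intro real_le_rsqrt) simp
qed

locale double_wiener_chaos =
  fixes M :: "'a measure" and W :: "'h::real_inner \<Rightarrow> 'a \<Rightarrow> real"
    and tens :: "'h \<Rightarrow> 'h \<Rightarrow> 't::real_inner" and I2 :: "'t \<Rightarrow> 'a \<Rightarrow> real"
  assumes isonormal: "isonormal_process M W"
    and tensor: "hilbert_tensor_square tens"
    and integral: "double_wiener_integral M W tens I2"
begin

sublocale prob_space M
  using isonormal by (simp add: isonormal_process_def)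

text \<open>The finite-rank symmetric tensors, a dense subspace of
  \<open>symmetric_square tens\<close>.\<close>

abbreviation "sym2_span \<equiv> span {tens a b + tens b a | a b. True}"

lemma I2_measurable: "f \<in> symmetric_square tens \<Longrightarrow> I2 f \<in> borel_measurable M"
  and I2_square_integrable: "f \<in> symmetric_square tens \<Longrightarrow> integrable M (\<lambda>x. (I2 f x)\<^sup>2)"
  and I2_linear: "f \<in> symmetric_square tens \<Longrightarrow> g \<in> symmetric_square tens \<Longrightarrow>
        AE x in M. I2 (a *\<^sub>R f + b *\<^sub>R g) x = a * I2 f x + b * I2 g x"
  and I2_square: "norm h = 1 \<Longrightarrow> AE x in M. I2 (tens h h) x = (W h x)\<^sup>2 - 1"
  and I2_isometry: "f \<in> symmetric_square tens \<Longrightarrow> g \<in> symmetric_square tens \<Longrightarrow>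
        (\<integral>x. I2 f x * I2 g x \<partial>M) = 2 * inner f g"
  using integral by (auto simp: double_wiener_integral_def)

lemma span_in_symmetric_square: "f \<in> sym2_span \<Longrightarrow> f \<in> symmetric_square tens"
  unfolding symmetric_square_def using closure_subset by blast

lemma tens_self_in_span: "tens h h \<in> sym2_span"
proof -
  have "tens h h = (1 / 2) *\<^sub>R (tens h h + tens h h)" by (simp flip: scaleR_2)
  also have "\<dots> \<in> sym2_span" by (intro span_scale span_base) blast
  finally show ?thesis .
qed

lemma I2_diagonal:
  assumes "finite A" "\<And>u. u \<in> A \<Longrightarrow> norm u = 1"
  shows "AE x in M. I2 (\<Sum>u\<in>A. l u *\<^sub>R tens u u) x = (\<Sum>u\<in>A. l u * ((W u x)\<^sup>2 - 1))"
  using assms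
proof (induction A rule: finite_induct)
  case empty
  \<comment> \<open>Linearity with both coefficients 0 gives I2 0 = 0 almost surely.\<close>
  have "0 \<in> symmetric_square tens" by (intro span_in_symmetric_square span_zero)
  from I2_linear[OF this this, of 0 0] show ?case by simp
next
  case (insert u A)
  have 1: "tens u u \<in> symmetric_square tens" by (intro span_in_symmetric_square tens_self_in_span)
  have 2: "(\<Sum>u\<in>A. l u *\<^sub>R tens u u) \<in> symmetric_square tens"
    by (intro span_in_symmetric_square span_sum span_scale tens_self_in_span)
  have "AE x in M. I2 (\<Sum>u\<in>A. l u *\<^sub>R tens u u) x = (\<Sum>u\<in>A. l u * ((W u x)\<^sup>2 - 1))"
    using insert by auto
  moreover have "AE x in M. I2 (tens u u) x = (W u x)\<^sup>2 - 1"
    using insert by (intro I2_square) auto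
  ultimately show ?case
    using I2_linear[OF 1 2, of "l u" 1] by eventually_elim (use insert.hyps in simp)
qed

lemma I2_dist:
  assumes f: "f \<in> symmetric_square tens" and g: "g \<in> symmetric_square tens"
  shows "integrable M (\<lambda>x. (I2 f x - I2 g x)\<^sup>2)"
    "(\<integral>x. (I2 f x - I2 g x)\<^sup>2 \<partial>M) = 2 * (norm (f - g))\<^sup>2"
proof -
  note fg = I2_square_integrable[OF f] I2_square_integrable[OF g]
    integrable_mult_of_squares[OF I2_measurable[OF f] I2_measurable[OF g] I2_square_integrable[OF f] I2_square_integrable[OF g]]
  have e: "(I2 f x - I2 g x)\<^sup>2 = (I2 f x)\<^sup>2 + (I2 g x)\<^sup>2 - 2 * (I2 f x * I2 g x)" for x
    by (simp add: power2_diff)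
  show "integrable M (\<lambda>x. (I2 f x - I2 g x)\<^sup>2)" unfolding e using fg by simp
  have "(\<integral>x. (I2 f x - I2 g x)\<^sup>2 \<partial>M) = (\<integral>x. (I2 f x)\<^sup>2 \<partial>M) + (\<integral>x. (I2 g x)\<^sup>2 \<partial>M) - 2 * (\<integral>x. I2 f x * I2 g x \<partial>M)"
    unfolding e using fg by simp
  also have "\<dots> = 2 * (norm (f - g))\<^sup>2"
    using I2_isometry[OF f f] I2_isometry[OF g g] I2_isometry[OF f g]
    by (simp add: power2_eq_square[of "I2 _ _"] power2_norm_eq_inner inner_diff inner_commute algebra_simps)
  finally show "(\<integral>x. (I2 f x - I2 g x)\<^sup>2 \<partial>M) = 2 * (norm (f - g))\<^sup>2" .
qed

lemma char_I2:
  assumes "f \<in> symmetric_square tens"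
  shows "char (distr M borel (I2 f)) t = (\<integral>x. iexp (t * I2 f x) \<partial>M)"
  unfolding char_def using I2_measurable[OF assms] by (subst integral_distr) auto

text \<open>e^(ity) is Lipschitz in y with constant |t|, the L1 norm is at most the L2 norm, and the
  isometry evaluates the latter. Thus approximation of tensors passes to characteristic
  functions.\<close>

lemma char_I2_dist:
  assumes f: "f \<in> symmetric_square tens" and g: "g \<in> symmetric_square tens"
  shows "norm (char (distr M borel (I2 f)) t - char (distr M borel (I2 g)) t) \<le> \<bar>t\<bar> * (sqrt 2 * norm (f - g))"
proof -
  note [measurable] = I2_measurable[OF f] I2_measurable[OF g]
  have i: "integrable M (\<lambda>x. iexp (t * Y x))" if [measurable]: "Y \<in> borel_measurable M" for Y
    by (rule integrable_const_bound[of _ 1]) (auto simp del: of_real_mult)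
  note L2 = expectation_abs_le_sqrt[of "\<lambda>x. I2 f x - I2 g x", OF _ I2_dist(1)[OF f g]]
  have "norm (char (distr M borel (I2 f)) t - char (distr M borel (I2 g)) t) = norm (\<integral>x. iexp (t * I2 f x) - iexp (t * I2 g x) \<partial>M)"
    unfolding char_I2[OF f] char_I2[OF g] by (subst Bochner_Integration.integral_diff) (auto simp del: of_real_mult intro!: i)
  also have "\<dots> \<le> (\<integral>x. norm (iexp (t * I2 f x) - iexp (t * I2 g x)) \<partial>M)"
    by (rule integral_norm_bound)
  also have "\<dots> \<le> (\<integral>x. \<bar>t\<bar> * \<bar>I2 f x - I2 g x\<bar> \<partial>M)"
  proof (rule integral_mono)
    show "integrable M (\<lambda>x. norm (iexp (t * I2 f x) - iexp (t * I2 g x)))"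
      by (intro integrable_norm Bochner_Integration.integrable_diff i) auto
    show "integrable M (\<lambda>x. \<bar>t\<bar> * \<bar>I2 f x - I2 g x\<bar>)"
      using L2(1) by simp
    show "norm (iexp (t * I2 f x) - iexp (t * I2 g x)) \<le> \<bar>t\<bar> * \<bar>I2 f x - I2 g x\<bar>" for x
      using norm_iexp_diff_le[of "t * I2 f x" "t * I2 g x"] by (simp add: abs_mult flip: right_diff_distrib)
  qed
  also have "\<dots> = \<bar>t\<bar> * expectation (\<lambda>x. \<bar>I2 f x - I2 g x\<bar>)" by simp
  also have "\<dots> \<le> \<bar>t\<bar> * sqrt (2 * (norm (f - g))\<^sup>2)"
    using L2(2) unfolding I2_dist(2)[OF f g] by (intro mult_left_mono) auto
  finally show ?thesis by (simp add: real_sqrt_mult)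
qed

text \<open>The square sum is the control kept on the eigenvalues: along a convergent sequence of
  tensors it bounds all of them at once.\<close>

lemma char_I2_span:
  assumes "f \<in> sym2_span"
  obtains A :: "'h set" and \<mu> where "finite A" "\<And>t. char (distr M borel (I2 f)) t = exp (\<Sum>u\<in>A. chi2_cgf (\<mu> u) t)"
    "(\<Sum>u\<in>A. (\<mu> u)\<^sup>2) = 4 * (norm f)\<^sup>2"
proof -
  obtain A l where A: "finite A" "orthonormal A" and f: "f = (\<Sum>u\<in>A. l u *\<^sub>R tens u u)" and n: "(norm f)\<^sup>2 = (\<Sum>u\<in>A. (l u)\<^sup>2)"
    using symmetric_tensor_diagonal[OF tensor assms] by blast
  have f': "f \<in> symmetric_square tens" using assms by (rule span_in_symmetric_square)
  have ae: "AE x in M. I2 f x = (\<Sum>u\<in>A. l u * ((W u x)\<^sup>2 - 1))"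
    unfolding f using A by (intro I2_diagonal) (auto simp: orthonormal_def)
  have [measurable]: "W h \<in> borel_measurable M" for h
    using isonormal_gaussian[OF isonormal, of "{h}" "\<lambda>_. 1"] by (simp add: centered_gaussian_def)
  note [measurable] = I2_measurable[OF f']
  have "char (distr M borel (I2 f)) t = exp (\<Sum>u\<in>A. chi2_cgf (2 * l u) t)" for t
  proof -
    have "char (distr M borel (I2 f)) t = (\<integral>x. iexp (t * (\<Sum>u\<in>A. l u * ((W u x)\<^sup>2 - 1))) \<partial>M)"
      unfolding char_I2[OF f'] using ae by (intro integral_cong_AE) (auto simp del: of_real_mult)
    then show ?thesis using isonormal_chi2_char[OF isonormal A] by simp
  qed
  moreover have "(\<Sum>u\<in>A. (2 * l u)\<^sup>2) = 4 * (norm f)\<^sup>2"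
    unfolding n by (simp add: power_mult_distrib sum_distrib_left)
  ultimately show ?thesis using A(1) by (intro that[of A "\<lambda>u. 2 * l u"])
qed

text \<open>Finite-rank tensors \<open>g m\<close> tend to \<open>f\<close>. Their log
  characteristic functions are holomorphic and bounded by 1 on a common disc, so along a subsequence
  their derivatives at 0 tend to those that define the cumulants of \<open>I2 f\<close>. Only
  finitely many orders are involved, so a single index serves all of them and the characteristic
  function.\<close>

lemma I2_spectral_approximation:
  assumes f: "f \<in> symmetric_square tens" and "\<epsilon> > 0"
  obtains A :: "'h set" and \<mu> where "finite A"
    "\<And>t. norm (char (distr M borel (I2 f)) t - exp (\<Sum>u\<in>A. chi2_cgf (\<mu> u) t)) \<le> \<epsilon> * \<bar>t\<bar>"
    "\<And>j. j \<in> {2..6} \<Longrightarrow> norm (cumulant j M (I2 f) - of_real (fact (j - 1) * (\<Sum>u\<in>A. \<mu> u ^ j) / 2)) < \<epsilon>"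
proof -
  obtain g where g: "\<And>m. g m \<in> sym2_span" and glim: "g \<longlonglongrightarrow> f"
    using f unfolding symmetric_square_def closure_sequential by blast
  have "\<forall>m. \<exists>A :: 'h set. \<exists>\<mu>. finite A \<and> (\<forall>t. char (distr M borel (I2 (g m))) t = exp (\<Sum>u\<in>A. chi2_cgf (\<mu> u) t)) \<and>
    (\<Sum>u\<in>A. (\<mu> u)\<^sup>2) = 4 * (norm (g m))\<^sup>2"
    using char_I2_span[OF g] by metis
  then obtain A :: "nat \<Rightarrow> 'h set" and \<mu> where A: "\<And>m. finite (A m)"
    and ch: "\<And>m t. char (distr M borel (I2 (g m))) t = exp (\<Sum>u\<in>A m. chi2_cgf (\<mu> m u) t)"
    and sq: "\<And>m. (\<Sum>u\<in>A m. (\<mu> m u)\<^sup>2) = 4 * (norm (g m))\<^sup>2"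
    by metis
  obtain D0 where D0: "\<And>m. norm (g m) \<le> D0"
    using convergent_imp_Bseq[of g] glim by (auto simp: convergent_def Bseq_def)
  \<comment> \<open>The root of the square sum is 2 |g m|, whence the factor 2; adding 1 makes
    \<open>D\<close> positive.\<close>
  define D where "D = 2 * \<bar>D0\<bar> + 1"
  have D: "D > 0" "(\<Sum>u\<in>A m. (\<mu> m u)\<^sup>2) \<le> D\<^sup>2" for m
  proof -
    show "D > 0" by (simp add: D_def)
    have "2 * norm (g m) \<le> D" using D0[of m] by (simp add: D_def)
    then have "(2 * norm (g m))\<^sup>2 \<le> D\<^sup>2" by (intro power_mono) auto
    then show "(\<Sum>u\<in>A m. (\<mu> m u)\<^sup>2) \<le> D\<^sup>2" unfolding sq by (simp add: power_mult_distrib)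
  qed
  have \<mu>_le: "\<bar>\<mu> m u\<bar> \<le> D" if "u \<in> A m" for m u
  proof -
    have "(\<mu> m u)\<^sup>2 \<le> (\<Sum>u\<in>A m. (\<mu> m u)\<^sup>2)" using A that by (intro member_le_sum) auto
    then have "(\<mu> m u)\<^sup>2 \<le> D\<^sup>2" using D(2)[of m] by linarith
    then show ?thesis using D(1) power2_le_imp_le[of "\<bar>\<mu> m u\<bar>" D] by simp
  qed
  \<comment> \<open>On this disc |\<mu> z| \<le> 1/2, which keeps 1 - i \<mu> z in the right
    half-plane, and the sum of |\<mu> z|^2 is at most D^2 r^2 = 1/4, within the bound 1 that fixes
    the branch of the logarithm.\<close>
  define r where "r = 1 / (2 * D)"
  have "r > 0" using D by (simp add: r_def)
  \<comment> \<open>The factor 1 is the weight in the general sums of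
    \<open>chi2_cgf\<close>.\<close>
  define F where "F m z = (\<Sum>u\<in>A m. 1 * chi2_cgf (\<mu> m u) z)" for m z
  have small: "norm (\<mu> m u * z) \<le> 1 / 2" if "u \<in> A m" "z \<in> ball 0 r" for m u and z :: complex
  proof -
    have "norm (\<mu> m u * z) \<le> D * r"
      using \<mu>_le[OF that(1)] that(2) D by (auto simp: norm_mult intro!: mult_mono)
    then show ?thesis using D by (simp add: r_def)
  qed
  have Re_small: "\<bar>Re (\<i> * \<mu> m u * z)\<bar> \<le> 1 / 2" if "u \<in> A m" "z \<in> ball 0 r" for m u and z :: complex
    using small[OF that] abs_Re_le_cmod[of "\<i> * \<mu> m u * z"] by (simp add: norm_mult)
  have hol: "F m holomorphic_on ball 0 r" for m
    unfolding F_def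
  proof (rule holomorphic_on_subset[OF holomorphic_on_sum_chi2_cgf])
    show "ball 0 r \<subseteq> {z. \<forall>u\<in>A m. Re (1 - \<i> * \<mu> m u * z) > 0}"
    proof (intro subsetI CollectI ballI)
      fix z u assume "z \<in> ball (0::complex) r" "u \<in> A m"
      from Re_small[OF this(2,1)] have "Re (\<i> * \<mu> m u * z) \<le> 1 / 2" by linarith
      then show "Re (1 - \<i> * \<mu> m u * z) > 0" by simp
    qed
  qed
  have bound: "norm (F m z) \<le> 1" if z: "z \<in> ball 0 r" for m z
  proof -
    have "norm (F m z) \<le> (\<Sum>u\<in>A m. (norm (\<mu> m u * z))\<^sup>2)"
      unfolding F_def
    proof (rule sum_norm_le)
      fix u assume "u \<in> A m"
      from Re_small[OF this z] show "norm (1 * chi2_cgf (\<mu> m u) z) \<le> (norm (\<mu> m u * z))\<^sup>2"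
        unfolding mult_1 by (intro norm_chi2_cgf_le) linarith
    qed
    also have "\<dots> = (\<Sum>u\<in>A m. (\<mu> m u)\<^sup>2) * (norm z)\<^sup>2"
      by (simp add: norm_mult power_mult_distrib sum_distrib_right)
    also have "\<dots> \<le> D\<^sup>2 * r\<^sup>2"
      using D z by (intro mult_mono power_mono) auto
    also have "\<dots> \<le> 1" using D(1) by (simp add: r_def power2_eq_square)
    finally show ?thesis .
  qed
  have gs: "g m \<in> symmetric_square tens" for m using g by (rule span_in_symmetric_square)
  have dist: "norm (char (distr M borel (I2 f)) t - exp (F m t)) \<le> \<bar>t\<bar> * (sqrt 2 * norm (f - g m))" for m t
    using char_I2_dist[OF f gs[of m], of t] unfolding ch F_def by simp
  have n0: "(\<lambda>m. sqrt 2 * norm (f - g m)) \<longlonglongrightarrow> 0"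
    using tendsto_diff[OF tendsto_const glim, of f] by (intro tendsto_mult_right_zero tendsto_norm_zero) simp
  have lim: "(\<lambda>m. exp (F m (of_real t))) \<longlonglongrightarrow> char (distr M borel (I2 f)) t" for t
  proof (rule LIM_zero_cancel, rule Lim_null_comparison)
    show "\<forall>\<^sub>F m in sequentially. norm (exp (F m (of_real t)) - char (distr M borel (I2 f)) t) \<le> \<bar>t\<bar> * (sqrt 2 * norm (f - g m))"
      using dist by (simp add: norm_minus_commute)
    show "(\<lambda>m. \<bar>t\<bar> * (sqrt 2 * norm (f - g m))) \<longlonglongrightarrow> 0" by (rule tendsto_mult_right_zero[OF n0])
  qed
  obtain s where s: "strict_mono s"
    and der: "\<And>j. (\<lambda>m. (deriv ^^ j) (F (s m)) 0) \<longlonglongrightarrow>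
      ((\<lambda>\<phi> t. vector_derivative \<phi> (at t)) ^^ j) (\<lambda>t. Ln (char (distr M borel (I2 f)) t)) 0"
    using cgf_derivatives_limit[OF \<open>r > 0\<close> hol bound lim] by blast
  have cum: "(\<lambda>m. of_real (fact (j - 1) * (\<Sum>u\<in>A (s m). \<mu> (s m) u ^ j) / 2)) \<longlonglongrightarrow> cumulant j M (I2 f)"
    if "j \<in> {2..6}" for j
  proof -
    have e: "(- \<i>) ^ j * (deriv ^^ j) (F m) 0 = of_real (fact (j - 1) * (\<Sum>u\<in>A m. \<mu> m u ^ j) / 2)" for m
      using higher_deriv_sum_chi2_cgf_0[OF A, of j "\<lambda>_. 1" "\<mu> m" m] that unfolding F_def[abs_def] by simp
    show ?thesis
      using tendsto_mult_left[OF der, of "(- \<i>) ^ j" j] unfolding cumulant_def e .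
  qed
  have "\<forall>\<^sub>F m in sequentially. \<forall>j\<in>{2..6}. dist (of_real (fact (j - 1) * (\<Sum>u\<in>A (s m). \<mu> (s m) u ^ j) / 2)) (cumulant j M (I2 f)) < \<epsilon>"
    using tendstoD[OF cum \<open>\<epsilon> > 0\<close>] by (intro eventually_ball_finite) auto
  moreover have "\<forall>\<^sub>F m in sequentially. sqrt 2 * norm (f - g (s m)) < \<epsilon>"
    using LIMSEQ_subseq_LIMSEQ[OF n0 s] \<open>\<epsilon> > 0\<close> by (intro order_tendstoD) (auto simp: comp_def)
  ultimately have "\<forall>\<^sub>F m in sequentially. (\<forall>j\<in>{2..6}. dist (of_real (fact (j - 1) * (\<Sum>u\<in>A (s m). \<mu> (s m) u ^ j) / 2)) (cumulant j M (I2 f)) < \<epsilon>)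
    \<and> sqrt 2 * norm (f - g (s m)) < \<epsilon>"
    by (rule eventually_conj)
  then obtain m where m: "\<forall>j\<in>{2..6}. dist (of_real (fact (j - 1) * (\<Sum>u\<in>A (s m). \<mu> (s m) u ^ j) / 2)) (cumulant j M (I2 f)) < \<epsilon>"
    "sqrt 2 * norm (f - g (s m)) < \<epsilon>"
    by (auto simp: eventually_sequentially)
  show ?thesis
  proof (rule that[of "A (s m)" "\<mu> (s m)"])
    show "norm (char (distr M borel (I2 f)) t - exp (\<Sum>u\<in>A (s m). chi2_cgf (\<mu> (s m) u) t)) \<le> \<epsilon> * \<bar>t\<bar>" for t
    proof -
      have "norm (char (distr M borel (I2 f)) t - exp (F (s m) t)) \<le> \<bar>t\<bar> * (sqrt 2 * norm (f - g (s m)))" by (rule dist)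
      also have "\<dots> \<le> \<bar>t\<bar> * \<epsilon>" using m(2) by (intro mult_left_mono) auto
      finally show ?thesis unfolding F_def by (simp add: mult.commute)
    qed
    show "norm (cumulant j M (I2 f) - of_real (fact (j - 1) * (\<Sum>u\<in>A (s m). \<mu> (s m) u ^ j) / 2)) < \<epsilon>" if "j \<in> {2..6}" for j
      using m(1) that by (simp add: dist_norm norm_minus_commute)
  qed (rule A)
qed

end

section \<open>Convergence of power sums\<close>

lemma isCont_chi2_cgf: "isCont (\<lambda>x. chi2_cgf x (complex_of_real t)) x"
proof -
  have "1 - \<i> * of_real x * of_real t \<notin> \<real>\<^sub>\<le>\<^sub>0" by (auto simp: complex_nonpos_Reals_iff)
  then show ?thesis unfolding chi2_cgf_def by (intro continuous_intros) auto
qed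

text \<open>The remainder \<open>r\<close> is continuous and vanishes at a and - b, where \<epsilon>
  x^2 is positive, so it stays below \<epsilon> x^2 near both points. Elsewhere (x - a)^2 (x + b)^2
  is at least \<open>d1\<^sup>2 * d2\<^sup>2\<close>, and \<open>C\<close> absorbs the global bound
  K x^2. The factor x^2 on every side makes the point 0, where small eigenvalues may accumulate,
  harmless.\<close>

lemma chi2_cgf_interpolation_bound:
  assumes ab: "a > 0" "b > 0" and "B > 0" "\<epsilon> > 0"
    and c: "2 * chi2_cgf a t = a\<^sup>2 * (c0 + c1 * a)" "2 * chi2_cgf (- b) t = b\<^sup>2 * (c0 - c1 * b)"
  obtains C where "C \<ge> 0" "\<And>x. \<bar>x\<bar> \<le> B \<Longrightarrow> norm (2 * chi2_cgf x (of_real t) - x\<^sup>2 * (c0 + c1 * x)) \<le>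
      \<epsilon> * x\<^sup>2 + C * (x\<^sup>2 * (x - a)\<^sup>2 * (x + b)\<^sup>2)"
proof -
  define r where "r x = 2 * chi2_cgf x (of_real t) - x\<^sup>2 * (c0 + c1 * x)" for x :: real
  have r0: "r a = 0" "r (- b) = 0" using c by (simp_all add: r_def)
  have cont: "isCont r x" for x
    unfolding r_def by (intro continuous_intros isCont_chi2_cgf)
  have ev: "\<forall>\<^sub>F x in nhds y. norm (r x) < \<epsilon> * x\<^sup>2" if "r y = 0" "y \<noteq> 0" for y
  proof -
    have "isCont (\<lambda>x. \<epsilon> * x\<^sup>2 - norm (r x)) y" by (intro continuous_intros cont)
    then have "((\<lambda>x. \<epsilon> * x\<^sup>2 - norm (r x)) \<longlongrightarrow> \<epsilon> * y\<^sup>2 - norm (r y)) (nhds y)"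
      using tendsto_at_iff_tendsto_nhds[of "\<lambda>x. \<epsilon> * x\<^sup>2 - norm (r x)" y] by (simp add: isCont_def)
    moreover have "\<epsilon> * y\<^sup>2 - norm (r y) > 0" using that \<open>\<epsilon> > 0\<close> by simp
    ultimately have "\<forall>\<^sub>F x in nhds y. \<epsilon> * x\<^sup>2 - norm (r x) > 0" by (rule order_tendstoD)
    then show ?thesis by eventually_elim simp
  qed
  obtain d1 where d1: "d1 > 0" "\<And>x. \<bar>x - a\<bar> < d1 \<Longrightarrow> norm (r x) < \<epsilon> * x\<^sup>2"
    using ev[OF r0(1)] ab unfolding eventually_nhds_metric by (auto simp: dist_real_def)
  obtain d2 where d2: "d2 > 0" "\<And>x. \<bar>x + b\<bar> < d2 \<Longrightarrow> norm (r x) < \<epsilon> * x\<^sup>2"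
    using ev[OF r0(2)] ab unfolding eventually_nhds_metric by (auto simp: dist_real_def)
  define K where "K = 2 * t\<^sup>2 + norm c0 + norm c1 * B"
  have K: "norm (r x) \<le> K * x\<^sup>2" if "\<bar>x\<bar> \<le> B" for x
  proof -
    have "norm (chi2_cgf x (of_real t)) \<le> (norm (complex_of_real x * of_real t))\<^sup>2"
      by (rule norm_chi2_cgf_le) simp
    then have 1: "norm (2 * chi2_cgf x (of_real t)) \<le> 2 * t\<^sup>2 * x\<^sup>2"
      by (simp add: norm_mult power_mult_distrib mult_ac)
    have "norm (c0 + c1 * x) \<le> norm c0 + norm c1 * \<bar>x\<bar>"
      using norm_triangle_ineq[of c0 "c1 * x"] by (simp add: norm_mult)
    also have "\<dots> \<le> norm c0 + norm c1 * B" using that by (intro add_left_mono mult_left_mono) auto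
    finally have "norm (x\<^sup>2 * (c0 + c1 * x)) \<le> x\<^sup>2 * (norm c0 + norm c1 * B)"
      unfolding norm_mult by (intro mult_mono) (auto simp: norm_power)
    with 1 have "norm (r x) \<le> 2 * t\<^sup>2 * x\<^sup>2 + x\<^sup>2 * (norm c0 + norm c1 * B)"
      unfolding r_def by (rule norm_triangle_le_diff[OF add_mono])
    then show ?thesis by (simp add: K_def algebra_simps)
  qed
  have "K \<ge> 0" using \<open>B > 0\<close> by (simp add: K_def)
  define C where "C = K / (d1\<^sup>2 * d2\<^sup>2)"
  have "C \<ge> 0" using \<open>K \<ge> 0\<close> by (simp add: C_def)
  have "norm (r x) \<le> \<epsilon> * x\<^sup>2 + C * (x\<^sup>2 * (x - a)\<^sup>2 * (x + b)\<^sup>2)" if x: "\<bar>x\<bar> \<le> B" for x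
  proof (cases "\<bar>x - a\<bar> < d1 \<or> \<bar>x + b\<bar> < d2")
    case True
    then have "norm (r x) < \<epsilon> * x\<^sup>2" using d1 d2 by auto
    moreover have "C * (x\<^sup>2 * (x - a)\<^sup>2 * (x + b)\<^sup>2) \<ge> 0" using \<open>C \<ge> 0\<close> by simp
    ultimately show ?thesis by linarith
  next
    case False
    then have "d1\<^sup>2 \<le> (x - a)\<^sup>2" "d2\<^sup>2 \<le> (x + b)\<^sup>2"
      using d1(1) d2(1) power_mono[of d1 "\<bar>x - a\<bar>" 2] power_mono[of d2 "\<bar>x + b\<bar>" 2] by auto
    then have "d1\<^sup>2 * d2\<^sup>2 \<le> (x - a)\<^sup>2 * (x + b)\<^sup>2" by (intro mult_mono) auto
    then have "C * x\<^sup>2 * (d1\<^sup>2 * d2\<^sup>2) \<le> C * x\<^sup>2 * ((x - a)\<^sup>2 * (x + b)\<^sup>2)"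
      using \<open>C \<ge> 0\<close> by (intro mult_left_mono) auto
    moreover have "C * x\<^sup>2 * (d1\<^sup>2 * d2\<^sup>2) = K * x\<^sup>2" using d1(1) d2(1) by (simp add: C_def)
    moreover have "\<epsilon> * x\<^sup>2 \<ge> 0" using \<open>\<epsilon> > 0\<close> by simp
    moreover have "C * x\<^sup>2 * ((x - a)\<^sup>2 * (x + b)\<^sup>2) = C * (x\<^sup>2 * (x - a)\<^sup>2 * (x + b)\<^sup>2)" by (simp only: mult_ac)
    ultimately show ?thesis using K[OF x] by linarith
  qed
  then show ?thesis unfolding r_def of_real_power by (rule that[OF \<open>C \<ge> 0\<close>])
qed

text \<open>The polynomial \<open>x\<^sup>2 (x - a)\<^sup>2 (x + b)\<^sup>2\<close> involves only the power sums of orders 2 to 6, and its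
  limiting sum vanishes, so asymptotically all the mass \<open>\<Sum>\<mu>\<^sup>2\<close> sits at \<open>a\<close> and \<open>- b\<close>;
  how it splits between the two points is read off from the power sums of orders 2 and 3.\<close>

lemma sum_chi2_cgf_tendsto:
  fixes A :: "nat \<Rightarrow> 'h set" and \<mu> :: "nat \<Rightarrow> 'h \<Rightarrow> real"
  assumes fin: "\<And>n. finite (A n)" and ab: "a > 0" "b > 0"
    and lim: "\<And>j. j \<in> {2..6} \<Longrightarrow> (\<lambda>n. (\<Sum>u\<in>A n. \<mu> n u ^ j) / 2) \<longlonglongrightarrow> p * a ^ j + q * (- b) ^ j"
  shows "(\<lambda>n. \<Sum>u\<in>A n. chi2_cgf (\<mu> n u) (of_real t)) \<longlonglongrightarrow>
     2 * p * chi2_cgf a t + 2 * q * chi2_cgf (- b) t"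
proof -
  define P where "P j n = (\<Sum>u\<in>A n. \<mu> n u ^ j)" for j n
  have P: "P j \<longlonglongrightarrow> 2 * (p * a ^ j + q * (- b) ^ j)" if "j \<in> {2..6}" for j
    using tendsto_mult_left[OF lim[OF that], of 2] by (simp add: P_def[abs_def])
  \<comment> \<open>The affine function c0 + c1 x interpolates 2 chi2_cgf x t / x^2 at a and - b;
    multiplied by x^2 it sums to a combination of the power sums of orders 2 and 3.\<close>
  define c1 c0 where "c1 = (2 * chi2_cgf a t / a\<^sup>2 - 2 * chi2_cgf (- b) t / b\<^sup>2) / (a + b)"
    and "c0 = 2 * chi2_cgf a t / a\<^sup>2 - c1 * a"
  have cb: "c0 - c1 * b = 2 * chi2_cgf (- b) t / b\<^sup>2"
  proof -
    have "complex_of_real a + b \<noteq> 0" using ab by (metis of_real_add of_real_eq_0_iff add_pos_pos less_irrefl)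
    then have "c1 * (a + b) = 2 * chi2_cgf a t / a\<^sup>2 - 2 * chi2_cgf (- b) t / b\<^sup>2" by (simp add: c1_def)
    then show ?thesis by (simp add: c0_def algebra_simps)
  qed
  have c: "2 * chi2_cgf a t = a\<^sup>2 * (c0 + c1 * a)" "2 * chi2_cgf (- b) t = b\<^sup>2 * (c0 - c1 * b)"
    using ab unfolding cb by (simp_all add: c0_def)
  define Q where "Q n = (\<Sum>u\<in>A n. (\<mu> n u)\<^sup>2 * (\<mu> n u - a)\<^sup>2 * (\<mu> n u + b)\<^sup>2)" for n
  have Q: "Q \<longlonglongrightarrow> 0"
  proof -
    \<comment> \<open>In these terms (x - a) (x + b) = x^2 + d x - e, which keeps the expansion
      short.\<close>
    define d e where "d = b - a" and "e = a * b"
    have pol: "x\<^sup>2 * (x - a)\<^sup>2 * (x + b)\<^sup>2 = x ^ 6 + 2 * d * x ^ 5 + (d\<^sup>2 - 2 * e) * x ^ 4 - 2 * d * e * x ^ 3 + e\<^sup>2 * x ^ 2" for x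
    proof -
      have "(x - a) * (x + b) = x\<^sup>2 + d * x - e" by (simp add: d_def e_def algebra_simps power2_eq_square)
      then have "x\<^sup>2 * (x - a)\<^sup>2 * (x + b)\<^sup>2 = x\<^sup>2 * (x\<^sup>2 + d * x - e)\<^sup>2"
        by (metis mult.assoc power_mult_distrib)
      also have "\<dots> = x ^ 6 + 2 * d * x ^ 5 + (d\<^sup>2 - 2 * e) * x ^ 4 - 2 * d * e * x ^ 3 + e\<^sup>2 * x ^ 2" by algebra
      finally show ?thesis .
    qed
    have Qeq: "Q n = P 6 n + 2 * d * P 5 n + (d\<^sup>2 - 2 * e) * P 4 n - 2 * d * e * P 3 n + e\<^sup>2 * P 2 n" for n
      unfolding Q_def pol P_def by (simp add: sum.distrib sum_subtractf sum_distrib_left)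
    let ?L = "\<lambda>j. 2 * (p * a ^ j + q * (- b) ^ j)"
    have "Q \<longlonglongrightarrow> ?L 6 + 2 * d * ?L 5 + (d\<^sup>2 - 2 * e) * ?L 4 - 2 * d * e * ?L 3 + e\<^sup>2 * ?L 2"
      unfolding Qeq by (intro tendsto_intros P) auto
    \<comment> \<open>The limit is the same polynomial evaluated with the masses 2 p at a and 2 q at
      - b, that is, at two of its zeros.\<close>
    also have "?L 6 + 2 * d * ?L 5 + (d\<^sup>2 - 2 * e) * ?L 4 - 2 * d * e * ?L 3 + e\<^sup>2 * ?L 2 =
      2 * (p * (a\<^sup>2 * (a - a)\<^sup>2 * (a + b)\<^sup>2) + q * ((- b)\<^sup>2 * (- b - a)\<^sup>2 * (- b + b)\<^sup>2))"
      unfolding pol by (simp add: algebra_simps)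
    also have "\<dots> = 0" by simp
    finally show ?thesis .
  qed
  obtain B0 where B0: "B0 > 0" "\<And>n. \<bar>P 2 n\<bar> \<le> B0"
    using convergent_imp_Bseq[of "P 2"] P[of 2] by (auto simp: convergent_def Bseq_def)
  \<comment> \<open>Each |\<mu>| is at most the root of the square sum, so all eigenvalues lie in
    one interval on which the interpolation bound holds.\<close>
  define B where "B = sqrt B0"
  have \<mu>_le: "\<bar>\<mu> n u\<bar> \<le> B" if "u \<in> A n" for n u
  proof -
    have "(\<mu> n u)\<^sup>2 \<le> P 2 n" unfolding P_def using fin that by (intro member_le_sum) auto
    also have "\<dots> \<le> B0" using B0(2)[of n] by linarith
    finally show ?thesis unfolding B_def by (simp add: real_le_rsqrt)
  qed
  have "B > 0" using B0 by (simp add: B_def)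
  let ?R = "\<lambda>n. (\<Sum>u\<in>A n. 2 * chi2_cgf (\<mu> n u) (of_real t)) - (c0 * P 2 n + c1 * P 3 n)"
  have "?R \<longlonglongrightarrow> 0"
  proof (rule tendstoI)
    fix \<epsilon> :: real assume "\<epsilon> > 0"
    \<comment> \<open>Chosen so that \<delta> times the square sum is at most \<epsilon> / 2. The
      resulting \<open>C\<close> does not depend on n, so C Q n still tends to 0.\<close>
    define \<delta> where "\<delta> = \<epsilon> / (2 * B0)"
    have "\<delta> > 0" using \<open>\<epsilon> > 0\<close> B0 by (simp add: \<delta>_def)
    obtain C where C: "C \<ge> 0" "\<And>x. \<bar>x\<bar> \<le> B \<Longrightarrow> norm (2 * chi2_cgf x (of_real t) - x\<^sup>2 * (c0 + c1 * x)) \<le>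
        \<delta> * x\<^sup>2 + C * (x\<^sup>2 * (x - a)\<^sup>2 * (x + b)\<^sup>2)"
      using chi2_cgf_interpolation_bound[OF ab \<open>B > 0\<close> \<open>\<delta> > 0\<close> c[unfolded of_real_power]] by auto
    have R_le: "norm (?R n) \<le> \<epsilon> / 2 + C * Q n" for n
    proof -
      have "?R n = (\<Sum>u\<in>A n. 2 * chi2_cgf (\<mu> n u) (of_real t) - (\<mu> n u)\<^sup>2 * (c0 + c1 * \<mu> n u))"
        unfolding P_def
        by (simp add: sum_subtractf sum.distrib sum_distrib_left algebra_simps power2_eq_square power3_eq_cube)
      also have "norm \<dots> \<le> (\<Sum>u\<in>A n. \<delta> * (\<mu> n u)\<^sup>2 + C * ((\<mu> n u)\<^sup>2 * (\<mu> n u - a)\<^sup>2 * (\<mu> n u + b)\<^sup>2))"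
        using C(2)[OF \<mu>_le] by (intro sum_norm_le) simp
      also have "\<dots> = \<delta> * P 2 n + C * Q n"
        unfolding P_def Q_def by (simp add: sum.distrib sum_distrib_left)
      also have "\<delta> * P 2 n \<le> \<delta> * B0" using \<open>\<delta> > 0\<close> B0(2)[of n] by (intro mult_left_mono) auto
      also have "\<delta> * B0 = \<epsilon> / 2" using B0 by (simp add: \<delta>_def)
      finally show ?thesis by simp
    qed
    have "(\<lambda>n. \<epsilon> / 2 + C * Q n) \<longlonglongrightarrow> \<epsilon> / 2 + C * 0" by (intro tendsto_intros Q)
    from order_tendstoD(2)[OF this, of \<epsilon>]
    have "\<forall>\<^sub>F n in sequentially. \<epsilon> / 2 + C * Q n < \<epsilon>"
      using \<open>\<epsilon> > 0\<close> by simp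
    then show "\<forall>\<^sub>F n in sequentially. dist (?R n) 0 < \<epsilon>"
      by eventually_elim (use R_le in \<open>auto simp only: dist_0_norm dist_commute[of _ 0] intro: le_less_trans\<close>)
  qed
  have "(\<lambda>n. (?R n + (c0 * P 2 n + c1 * P 3 n)) / 2) \<longlonglongrightarrow> (0 + (c0 * of_real (2 * (p * a ^ 2 + q * (- b) ^ 2)) + c1 * of_real (2 * (p * a ^ 3 + q * (- b) ^ 3)))) / 2"
    by (intro tendsto_intros \<open>?R \<longlonglongrightarrow> 0\<close> P) auto
  also have "(\<lambda>n. (?R n + (c0 * P 2 n + c1 * P 3 n)) / 2) = (\<lambda>n. \<Sum>u\<in>A n. chi2_cgf (\<mu> n u) (of_real t))"
    by (simp add: sum_distrib_left[symmetric])
  also have "(0 + (c0 * of_real (2 * (p * a ^ 2 + q * (- b) ^ 2)) + c1 * of_real (2 * (p * a ^ 3 + q * (- b) ^ 3)))) / 2 =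
      p * (a\<^sup>2 * (c0 + c1 * a)) + q * (b\<^sup>2 * (c0 - c1 * b))"
    by (simp add: field_simps power2_eq_square power3_eq_cube)
  also have "\<dots> = 2 * p * chi2_cgf a t + 2 * q * chi2_cgf (- b) t"
    unfolding c[symmetric] by simp
  finally show ?thesis by simp
qed

section \<open>Weak convergence and the metric of order three\<close>

lemma W3_bounded_Lipschitz:
  assumes "h \<in> W3"
  shows "\<bar>h x\<bar> \<le> 1" "\<bar>h x - h y\<bar> \<le> \<bar>x - y\<bar>" "h \<in> borel_measurable borel"
proof -
  have b: "\<bar>h x\<bar> \<le> 1" "\<bar>deriv h x\<bar> \<le> 1" for x
  proof -
    have "\<bar>(deriv ^^ 0) h x\<bar> \<le> 1" "\<bar>(deriv ^^ 1) h x\<bar> \<le> 1"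
      using assms unfolding W3_def by (blast intro: zero_le one_le_numeral)+
    then show "\<bar>h x\<bar> \<le> 1" "\<bar>deriv h x\<bar> \<le> 1" by simp_all
  qed
  show "\<bar>h x\<bar> \<le> 1" by (rule b)
  have "(deriv ^^ 0) h differentiable (at x)" for x
    using assms unfolding W3_def by (blast intro: zero_less_numeral)
  then have d: "h differentiable (at x)" for x by simp
  then have "(h has_field_derivative deriv h x) (at x)" for x
    by (simp add: DERIV_deriv_iff_real_differentiable)
  then have "norm (h x - h y) \<le> 1 * norm (x - y)"
    by (intro field_differentiable_bound[of UNIV h "deriv h"]) (auto simp: b)
  then show "\<bar>h x - h y\<bar> \<le> \<bar>x - y\<bar>" by simp
  have "continuous_on UNIV h"
    using d by (intro continuous_at_imp_continuous_on ballI differentiable_imp_continuous_within)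
  then show "h \<in> borel_measurable borel" by (rule borel_measurable_continuous_onI)
qed

text \<open>Keeps the supremum in \<open>d3\<close> from ranging over the empty set, and its
  contribution 0 bounds \<open>d3\<close> below.\<close>

lemma zero_in_W3: "(\<lambda>x. 0) \<in> W3"
proof -
  have "(deriv ^^ k) (\<lambda>x::real. 0::real) = (\<lambda>x. 0)" for k by (induction k) auto
  then show ?thesis by (simp add: W3_def)
qed

text \<open>By Skorohod's theorem the weak convergence may be assumed to be almost sure, and a function in
  \<open>W3\<close> moves by at most \<open>min 2 \<bar>x - y\<bar>\<close> between \<open>x\<close> and \<open>y\<close>, uniformly in the function.\<close>

lemma weak_conv_imp_d3_tendsto_0:
  fixes M :: "nat \<Rightarrow> 'a measure" and Y :: "nat \<Rightarrow> 'a \<Rightarrow> real" and X :: "'b \<Rightarrow> real"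
  assumes M: "\<And>n. prob_space (M n)" and [measurable]: "\<And>n. Y n \<in> borel_measurable (M n)"
    and N: "prob_space N" and [measurable]: "X \<in> borel_measurable N"
    and conv: "weak_conv_m (\<lambda>n. distr (M n) borel (Y n)) (distr N borel X)"
  shows "(\<lambda>n. d3 (M n) (Y n) N X) \<longlonglongrightarrow> 0"
proof -
  have "real_distribution (distr (M n) borel (Y n))" for n
    using M by (intro prob_space.real_distribution_distr) auto
  moreover have "real_distribution (distr N borel X)"
    using N by (intro prob_space.real_distribution_distr) auto
  ultimately obtain \<Omega> :: "real measure" and Ys Y' where \<Omega>: "prob_space \<Omega>"
    and Ys[measurable]: "\<And>n. Ys n \<in> borel_measurable \<Omega>" and dY: "\<And>n. distr \<Omega> borel (Ys n) = distr (M n) borel (Y n)"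
    and Y'[measurable]: "Y' \<in> borel_measurable \<Omega>" and dX: "distr \<Omega> borel Y' = distr N borel X"
    and lim: "\<And>x. x \<in> space \<Omega> \<Longrightarrow> (\<lambda>n. Ys n x) \<longlonglongrightarrow> Y' x"
    using Skorohod[OF _ _ conv] by force
  interpret \<Omega>: prob_space \<Omega> by fact
  define e where "e n = (\<integral>x. min 2 \<bar>Ys n x - Y' x\<bar> \<partial>\<Omega>)" for n
  have "e \<longlonglongrightarrow> (\<integral>x. 0 \<partial>\<Omega>)"
    unfolding e_def
  proof (rule integral_dominated_convergence[where w="\<lambda>_. 2"])
    have "(\<lambda>n. min 2 \<bar>Ys n x - Y' x\<bar>) \<longlonglongrightarrow> min 2 \<bar>Y' x - Y' x\<bar>" if "x \<in> space \<Omega>" for x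
      using lim[OF that] by (intro tendsto_intros)
    then show "AE x in \<Omega>. (\<lambda>n. min 2 \<bar>Ys n x - Y' x\<bar>) \<longlonglongrightarrow> 0" by (intro AE_I2) simp
  qed auto
  then have e0: "e \<longlonglongrightarrow> 0" by simp
  have bnd: "\<bar>(\<integral>x. h (Y n x) \<partial>M n) - (\<integral>x. h (X x) \<partial>N)\<bar> \<le> e n" if h: "h \<in> W3" for h n
  proof -
    note [measurable] = W3_bounded_Lipschitz(3)[OF h]
    have i: "integrable \<Omega> (\<lambda>x. h (Z x))" if [measurable]: "Z \<in> borel_measurable \<Omega>" for Z
      using W3_bounded_Lipschitz(1)[OF h] by (intro \<Omega>.integrable_const_bound[of _ 1]) auto
    have "(\<integral>x. h (Y n x) \<partial>M n) = (\<integral>x. h (Ys n x) \<partial>\<Omega>)"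
      using integral_distr[of "Y n" "M n" borel h] integral_distr[of "Ys n" \<Omega> borel h] by (simp add: dY)
    moreover have "(\<integral>x. h (X x) \<partial>N) = (\<integral>x. h (Y' x) \<partial>\<Omega>)"
      using integral_distr[of X N borel h] integral_distr[of Y' \<Omega> borel h] by (simp add: dX)
    ultimately have "\<bar>(\<integral>x. h (Y n x) \<partial>M n) - (\<integral>x. h (X x) \<partial>N)\<bar> = \<bar>\<integral>x. h (Ys n x) - h (Y' x) \<partial>\<Omega>\<bar>"
      using i by simp
    also have "\<dots> \<le> (\<integral>x. \<bar>h (Ys n x) - h (Y' x)\<bar> \<partial>\<Omega>)" by (rule integral_abs_bound)
    also have "\<dots> \<le> e n"
      unfolding e_def
    proof (rule integral_mono)
      show "integrable \<Omega> (\<lambda>x. \<bar>h (Ys n x) - h (Y' x)\<bar>)" using i by simp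
      show "integrable \<Omega> (\<lambda>x. min 2 \<bar>Ys n x - Y' x\<bar>)"
        by (rule \<Omega>.integrable_const_bound[of _ 2]) auto
      show "\<bar>h (Ys n x) - h (Y' x)\<bar> \<le> min 2 \<bar>Ys n x - Y' x\<bar>" for x
        using W3_bounded_Lipschitz(2)[OF h, of "Ys n x" "Y' x"]
          W3_bounded_Lipschitz(1)[OF h, of "Ys n x"] W3_bounded_Lipschitz(1)[OF h, of "Y' x"] by linarith
    qed
    finally show ?thesis .
  qed
  have "d3 (M n) (Y n) N X \<le> e n" for n
    unfolding d3_def using zero_in_W3 bnd by (intro cSUP_least) auto
  moreover have "0 \<le> d3 (M n) (Y n) N X" for n
  proof -
    \<comment> \<open>Boundedness must be known before a real \<open>SUP\<close> can be compared
      with one of its members.\<close>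
    have "bdd_above ((\<lambda>h. \<bar>(\<integral>x. h (Y n x) \<partial>M n) - (\<integral>x. h (X x) \<partial>N)\<bar>) ` W3)"
      using bnd by (intro bdd_aboveI[of _ "e n"]) auto
    from cSUP_upper[OF zero_in_W3 this] show ?thesis by (simp add: d3_def)
  qed
  ultimately show ?thesis
    by (intro tendsto_sandwich[OF _ _ tendsto_const e0]) auto
qed

text \<open>The sort \<open>polish_space\<close> carries the separability and completeness of the
  Hilbert space. The hypothesis speaks of \<open>cumulant j N X\<close>, so its explicit value is
  made part of the conclusion, and convergence in distribution is stated beside that of
  \<open>d3\<close>.\<close>

theorem corollary4p10:
  fixes \<alpha>\<^sub>1 p\<^sub>1 \<alpha>\<^sub>2 p\<^sub>2 :: real
    and N :: "'b measure" and X :: "'b \<Rightarrow> real"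
    and M :: "'a measure"
    and W :: "'h::{real_inner, polish_space} \<Rightarrow> 'a \<Rightarrow> real"
    and tens :: "'h \<Rightarrow> 'h \<Rightarrow> 't::{real_inner, complete_space}"
    and I2 :: "'t \<Rightarrow> 'a \<Rightarrow> real"
    and f :: "nat \<Rightarrow> 't"
  assumes "\<alpha>\<^sub>1 > 0" "p\<^sub>1 > 0" "\<alpha>\<^sub>2 > 0" "p\<^sub>2 > 0"
    and "\<alpha>\<^sub>1 * \<alpha>\<^sub>2 > 1 + \<bar>\<alpha>\<^sub>1 - \<alpha>\<^sub>2\<bar>"
    and "p\<^sub>1 / p\<^sub>2 = \<alpha>\<^sub>1 / \<alpha>\<^sub>2"
    and "prob_space N" "X \<in> borel_measurable N"
    and "distr N borel X = bilateral_gamma \<alpha>\<^sub>1 p\<^sub>1 \<alpha>\<^sub>2 p\<^sub>2"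
    and "isonormal_process M W"
    and "hilbert_tensor_square tens"
    and "double_wiener_integral M W tens I2"
    and "\<And>n. n \<ge> 1 \<Longrightarrow> f n \<in> symmetric_square tens"
    and "\<And>j. 2 \<le> j \<Longrightarrow> j \<le> 6 \<Longrightarrow> (\<lambda>n. cumulant j M (I2 (f n))) \<longlonglongrightarrow> cumulant j N X"
  shows "(\<forall>j\<in>{2..6}. cumulant j N X =
            complex_of_real (fact (j - 1) * (p\<^sub>1 / \<alpha>\<^sub>1 ^ j + (-1) ^ j * (p\<^sub>2 / \<alpha>\<^sub>2 ^ j)))) \<and>
         (\<lambda>n. d3 M (I2 (f n)) N X) \<longlonglongrightarrow> 0 \<and>
         weak_conv_m (\<lambda>n. distr M borel (I2 (f n))) (distr N borel X)"
proof -
  note pos = \<open>\<alpha>\<^sub>1 > 0\<close> \<open>p\<^sub>1 > 0\<close> \<open>\<alpha>\<^sub>2 > 0\<close> \<open>p\<^sub>2 > 0\<close>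
  interpret double_wiener_chaos M W tens I2
    using assms by (simp add: double_wiener_chaos_def)
  interpret N: prob_space N by fact
  define a b where "a = 1 / \<alpha>\<^sub>1" and "b = 1 / \<alpha>\<^sub>2"
  have ab: "a > 0" "b > 0" using pos by (simp_all add: a_def b_def)
  \<comment> \<open>Condition (ii) in the form in which it acts: the two gamma variables have the
    same mean.\<close>
  have centred: "p\<^sub>1 * a = p\<^sub>2 * b"
    using \<open>p\<^sub>1 / p\<^sub>2 = \<alpha>\<^sub>1 / \<alpha>\<^sub>2\<close> pos by (simp add: a_def b_def field_simps)
  have charX: "char (distr N borel X) t = exp (2 * p\<^sub>1 * chi2_cgf a t + 2 * p\<^sub>2 * chi2_cgf (- b) t)" for t
  proof -
    \<comment> \<open>These are the linear terms. By \<open>centred\<close> they cancel with their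
      weights, so the compensated logarithms of \<open>chi2_cgf\<close> may replace the plain ones
      of the bilateral gamma law; the factor 2 undoes the division by 2 in
      \<open>chi2_cgf\<close>.\<close>
    define E1 E2 where "E1 = \<i> * of_real a * of_real t" and "E2 = \<i> * of_real b * of_real t"
    have E: "\<i> * of_real (t / \<alpha>\<^sub>1) = E1" "\<i> * of_real (t / \<alpha>\<^sub>2) = E2"
      by (simp_all add: a_def b_def E1_def E2_def)
    have "p\<^sub>1 * E1 = p\<^sub>2 * E2"
      using arg_cong[OF centred, of "\<lambda>c. \<i> * of_real c * of_real t"] by (simp add: E1_def E2_def mult_ac)
    then have "- p\<^sub>1 * L1 + - p\<^sub>2 * L2 = p\<^sub>1 * (- L1 - E1) + p\<^sub>2 * (- L2 + E2)" for L1 L2 :: complex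
      by (simp add: right_diff_distrib distrib_left)
    moreover have "2 * p\<^sub>1 * chi2_cgf a t = p\<^sub>1 * (- Ln (1 - E1) - E1)"
      "2 * p\<^sub>2 * chi2_cgf (- b) t = p\<^sub>2 * (- Ln (1 + E2) + E2)"
      by (simp_all add: chi2_cgf_def E1_def E2_def)
    ultimately show ?thesis
      unfolding \<open>distr N borel X = _\<close> char_bilateral_gamma[OF pos] E exp_add[symmetric] by (simp only: of_real_minus of_real_mult of_real_numeral)
  qed
  have cumX: "cumulant j N X = of_real (fact (j - 1) * (p\<^sub>1 * a ^ j + p\<^sub>2 * (- b) ^ j))" if "j \<ge> 2" for j
  proof -
    \<comment> \<open>The points a and - b are indexed by \<open>bool\<close>, which brings the two
      terms into the form of a sum over a finite index set.\<close>
    let ?w = "\<lambda>u. if u then 2 * p\<^sub>1 else 2 * p\<^sub>2" and ?x = "\<lambda>u. if u then a else - b"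
    have "cumulant j N X = of_real (fact (j - 1) * (\<Sum>u\<in>UNIV. ?w u * ?x u ^ j) / 2)"
      by (rule cumulant_of_cgf) (use that in \<open>auto simp: charX UNIV_bool add.commute\<close>)
    also have "fact (j - 1) * (\<Sum>u\<in>UNIV. ?w u * ?x u ^ j) / 2 = fact (j - 1) * (p\<^sub>1 * a ^ j + p\<^sub>2 * (- b) ^ j)"
      by (simp add: UNIV_bool distrib_left)
    finally show ?thesis .
  qed
  \<comment> \<open>Nothing is assumed about \<open>f 0\<close>, so the argument runs along
    \<open>Suc n\<close>; the tolerance 1 / (n + 1) disappears in the limit.\<close>
  have "\<forall>n. \<exists>A :: 'h set. \<exists>\<mu>. finite A \<and>
      (\<forall>t. norm (char (distr M borel (I2 (f (Suc n)))) t - exp (\<Sum>u\<in>A. chi2_cgf (\<mu> u) t)) \<le> inverse (Suc n) * \<bar>t\<bar>) \<and>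
      (\<forall>j\<in>{2..6}. norm (cumulant j M (I2 (f (Suc n))) - of_real (fact (j - 1) * (\<Sum>u\<in>A. \<mu> u ^ j) / 2)) < inverse (Suc n))"
  proof
    fix n
    have "f (Suc n) \<in> symmetric_square tens" "inverse (real (Suc n)) > 0" using assms(13) by auto
    from I2_spectral_approximation[OF this] show "\<exists>A :: 'h set. \<exists>\<mu>. finite A \<and>
      (\<forall>t. norm (char (distr M borel (I2 (f (Suc n)))) t - exp (\<Sum>u\<in>A. chi2_cgf (\<mu> u) t)) \<le> inverse (Suc n) * \<bar>t\<bar>) \<and>
      (\<forall>j\<in>{2..6}. norm (cumulant j M (I2 (f (Suc n))) - of_real (fact (j - 1) * (\<Sum>u\<in>A. \<mu> u ^ j) / 2)) < inverse (Suc n))"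
      by metis
  qed
  then obtain A :: "nat \<Rightarrow> 'h set" and \<mu> where fin: "\<And>n. finite (A n)"
    and ch: "\<And>n t. norm (char (distr M borel (I2 (f (Suc n)))) t - exp (\<Sum>u\<in>A n. chi2_cgf (\<mu> n u) t)) \<le> inverse (Suc n) * \<bar>t\<bar>"
    and cum: "\<And>n j. j \<in> {2..6} \<Longrightarrow>
      norm (cumulant j M (I2 (f (Suc n))) - of_real (fact (j - 1) * (\<Sum>u\<in>A n. \<mu> n u ^ j) / 2)) < inverse (Suc n)"
    by metis
  have inv0: "(\<lambda>n. inverse (real (Suc n))) \<longlonglongrightarrow> 0" by (rule LIMSEQ_inverse_real_of_nat)
  have power_sums: "(\<lambda>n. (\<Sum>u\<in>A n. \<mu> n u ^ j) / 2) \<longlonglongrightarrow> p\<^sub>1 * a ^ j + p\<^sub>2 * (- b) ^ j" if j: "j \<in> {2..6}" for j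
  proof -
    have "2 \<le> j" using j by simp
    let ?S = "\<lambda>n. complex_of_real (fact (j - 1) * (\<Sum>u\<in>A n. \<mu> n u ^ j) / 2)"
    have "(\<lambda>n. cumulant j M (I2 (f (Suc n))) - ?S n) \<longlonglongrightarrow> 0"
      by (rule Lim_null_comparison[OF _ inv0]) (rule always_eventually, intro allI less_imp_le cum j)
    moreover have "(\<lambda>n. cumulant j M (I2 (f (Suc n)))) \<longlonglongrightarrow> cumulant j N X"
      using assms(14)[of j] j by (intro LIMSEQ_Suc) auto
    ultimately have "?S \<longlonglongrightarrow> cumulant j N X - 0"
      using tendsto_diff by fastforce
    then have "(\<lambda>n. fact (j - 1) * (\<Sum>u\<in>A n. \<mu> n u ^ j) / 2) \<longlonglongrightarrow> fact (j - 1) * (p\<^sub>1 * a ^ j + p\<^sub>2 * (- b) ^ j)"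
      unfolding diff_0_right cumX[OF \<open>2 \<le> j\<close>] tendsto_of_real_iff .
    from tendsto_divide[OF this tendsto_const[of "fact (j - 1)"]] show ?thesis by simp
  qed
  have char_lim: "(\<lambda>n. char (distr M borel (I2 (f (Suc n)))) t) \<longlonglongrightarrow> char (distr N borel X) t" for t
  proof -
    have "(\<lambda>n. exp (\<Sum>u\<in>A n. chi2_cgf (\<mu> n u) t)) \<longlonglongrightarrow> char (distr N borel X) t"
      unfolding charX using sum_chi2_cgf_tendsto[OF fin ab power_sums, of t]
      by (intro tendsto_exp) simp
    moreover have "(\<lambda>n. char (distr M borel (I2 (f (Suc n)))) t - exp (\<Sum>u\<in>A n. chi2_cgf (\<mu> n u) t)) \<longlonglongrightarrow> 0"
      using ch by (intro Lim_null_comparison[OF _ tendsto_mult_left_zero[OF inv0, of "\<bar>t\<bar>"]]) auto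
    ultimately show ?thesis using tendsto_add by fastforce
  qed
  have meas: "I2 (f (Suc n)) \<in> borel_measurable M" for n using assms(13) by (intro I2_measurable) auto
  have weak: "weak_conv_m (\<lambda>n. distr M borel (I2 (f (Suc n)))) (distr N borel X)"
    using meas \<open>X \<in> borel_measurable N\<close>
    by (intro levy_continuity char_lim real_distribution_distr N.real_distribution_distr)
  have d3: "(\<lambda>n. d3 M (I2 (f (Suc n))) N X) \<longlonglongrightarrow> 0"
    using meas \<open>X \<in> borel_measurable N\<close> weak prob_space_axioms N.prob_space_axioms
    by (intro weak_conv_imp_d3_tendsto_0)
  \<comment> \<open>The index shift is undone here: the term at 0 does not influence a
    limit.\<close>
  have "weak_conv_m (\<lambda>n. distr M borel (I2 (f n))) (distr N borel X)"
    using weak unfolding weak_conv_m_def weak_conv_def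
    by (auto intro: LIMSEQ_imp_Suc)
  moreover have "(\<lambda>n. d3 M (I2 (f n)) N X) \<longlonglongrightarrow> 0" using d3 by (rule LIMSEQ_imp_Suc)
  moreover have "p\<^sub>1 * a ^ j + p\<^sub>2 * (- b) ^ j = p\<^sub>1 / \<alpha>\<^sub>1 ^ j + (-1) ^ j * (p\<^sub>2 / \<alpha>\<^sub>2 ^ j)" for j
    by (simp add: a_def b_def power_divide power_minus[of b] power_minus[of "1 / \<alpha>\<^sub>2"])
  ultimately show ?thesis using cumX by simp
qed

end
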